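(* Let $n\ge 45$ and let $r$ be an integer with $1\le r\le 2n+2$. Then the classical associahedron $\mathcal{A}_n$ admits an $r$-rainbow cycle.
   Context: Fix a convex $n$-gon. The classical associahedron $\mathcal{A}_n$ is the graph whose vertices are the triangulations of the $n$-gon (by non-crossing diagonals), two triangulations being adjacent if they differ by a flip: given a triangulation $T$ and an interior diagonal $e$ of $T$, the two triangles of $T$ containing $e$ form a quadrilateral, and the flip of $e$ replaces $e$ by the other diagonal of this quadrilateral. Each flip is colored by the diagonal that is flipped (removed). An $r$-rainbow cycle in $\mathcal{A}_n$ is a cycle $T_1,T_2,\dots,T_k,T_1$ of pairwise distinct triangulations, consecutive ones (cyclically) differing by a flip, such that every one of the $\binom{n}{2}-n$ diagonals of the $n$-gon is the flipped (removed) diagonal in exactly $r$ of the $k$ flips of the cycle (equivalently, since the walk is closed, every diagonal is introduced by exactly $r$ of the flips). *)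

theory Defs
  imports Main
begin

text \<open>
  The vertices of the convex \<open>n\<close>-gon are labelled \<open>0, \<dots>, n - 1\<close> in cyclic order. Sides
  and diagonals are represented by the two-element set of their endpoints. By convexity, whether
  two diagonals cross depends only on the labels of their endpoints.
\<close>

definition sides :: "nat \<Rightarrow> nat set set" where
  "sides n = {{i, Suc i mod n} | i. i < n}"

definition diagonals :: "nat \<Rightarrow> nat set set" where
  "diagonals n = {{i, j} | i j. i < n \<and> j < n \<and> i \<noteq> j} - sides n"

text \<open>Two diagonals cross (in their interiors) iff their endpoints strictly interleave.\<close>

definition crossing :: "nat set \<Rightarrow> nat set \<Rightarrow> bool" where
  "crossing e f \<longleftrightarrow>
     (\<exists>a b c d. a < b \<and> b < c \<and> c < d \<and>
        (e = {a, c} \<and> f = {b, d} \<or> e = {b, d} \<and> f = {a, c}))"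

definition noncrossing :: "nat set set \<Rightarrow> bool" where
  "noncrossing T \<longleftrightarrow> (\<forall>e\<in>T. \<forall>f\<in>T. \<not> crossing e f)"

text \<open>
  A triangulation is identified with its set of diagonals (the sides are left out): it is an
  inclusion-maximal set of pairwise non-crossing diagonals.
\<close>

definition triangulation :: "nat \<Rightarrow> nat set set \<Rightarrow> bool" where
  "triangulation n T \<longleftrightarrow>
     T \<subseteq> diagonals n \<and> noncrossing T \<and>
     (\<forall>S. T \<subseteq> S \<and> S \<subseteq> diagonals n \<and> noncrossing S \<longrightarrow> S = T)"

text \<open>
  As the polygon is convex and has no interior vertices, three vertices that are pairwise joined
  by sides or by diagonals of \<open>T\<close> span a face of \<open>T\<close>.
\<close>

definition triangle_of :: "nat \<Rightarrow> nat set set \<Rightarrow> nat \<Rightarrow> nat \<Rightarrow> nat \<Rightarrow> bool" where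
  "triangle_of n T a b c \<longleftrightarrow>
     a \<noteq> b \<and> b \<noteq> c \<and> a \<noteq> c \<and> {{a, b}, {b, c}, {a, c}} \<subseteq> T \<union> sides n"

text \<open>
  \<open>flip n T e T'\<close>: the triangulation \<open>T'\<close> arises from the triangulation \<open>T\<close> by flipping its
  diagonal \<open>e = {a, c}\<close>. The two triangles \<open>a b c\<close> and \<open>a d c\<close> of \<open>T\<close> containing \<open>e\<close> form the
  quadrilateral \<open>a b c d\<close>, whose other diagonal is \<open>{b, d}\<close>.
\<close>

definition flip :: "nat \<Rightarrow> nat set set \<Rightarrow> nat set \<Rightarrow> nat set set \<Rightarrow> bool" where
  "flip n T e T' \<longleftrightarrow>
     triangulation n T \<and> triangulation n T' \<and> e \<in> T \<and>
     (\<exists>a b c d. e = {a, c} \<and> b \<noteq> d \<and> triangle_of n T a b c \<and> triangle_of n T a d c \<and>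
        T' = insert {b, d} (T - {e}))"

definition assoc_vertices :: "nat \<Rightarrow> nat set set set" where
  "assoc_vertices n = {T. triangulation n T}"

definition assoc_adj :: "nat \<Rightarrow> nat set set \<Rightarrow> nat set set \<Rightarrow> bool" where
  "assoc_adj n T T' \<longleftrightarrow> (\<exists>e. flip n T e T')"

text \<open>A cycle is given by the list of its vertices; the last vertex is adjacent to the first.\<close>

definition assoc_cycle :: "nat \<Rightarrow> nat set set list \<Rightarrow> bool" where
  "assoc_cycle n Ts \<longleftrightarrow>
     3 \<le> length Ts \<and> distinct Ts \<and> set Ts \<subseteq> assoc_vertices n \<and>
     (\<forall>i<length Ts. assoc_adj n (Ts ! i) (Ts ! (Suc i mod length Ts)))"

definition rainbow_cycle :: "nat \<Rightarrow> nat \<Rightarrow> nat set set list \<Rightarrow> bool" where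
  "rainbow_cycle n r Ts \<longleftrightarrow>
     assoc_cycle n Ts \<and>
     (\<forall>e\<in>diagonals n.
        card {i. i < length Ts \<and> flip n (Ts ! i) e (Ts ! (Suc i mod length Ts))} = r)"

end

theory Submission imports Defs begin

text \<open>
  A zigzag triangulation has about \<open>n / 2\<close> pairwise independent flips, and performing all of them
  rotates it by half a step; after \<open>n\<close> half steps it returns, and every diagonal has been flipped
  once. In each half step we replace the direct path across the cube of independent flips by a
  self-avoiding path that flips every coordinate \<open>2 s + 1\<close> times. A diagonal is the lower value of a
  coordinate in one cube and the upper value in another one, so it is then removed
  \<open>(s + 1) + s\<close> times. For \<open>r = 2 s + 2\<close> a second monotone tour, which flips every
  diagonal once, is spliced in through wider triangulations that meet none of the cubes.
\<close>

section \<open>Balanced self-avoiding walks in a cube\<close>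

text \<open>With the same odd number of flips in every coordinate, a tour through the cubes gives
  every diagonal an odd total; this is why even \<open>r\<close> needs flips outside the cubes.
  Inside a cube the obstacle is balance: a Gray code visits many vertices but need not use its
  coordinates equally often. Conjugating by all rotations of one word evens this out, at the price
  of sparse letters: only about a third of the coordinates can carry the Gray code, of which a
  prefix of length \<open>s\<close> is used. A cube has at least \<open>(n - 3) div 2\<close>
  coordinates, so an exponential in about \<open>n / 6\<close> has to exceed \<open>s\<close>, which
  reaches \<open>n\<close> for the largest \<open>r\<close>. Hence the lower bound on
  \<open>n\<close>. Distinctness between cubes rests on one invariant: lifted to the universal
  cover, a chord has as height the sum of its endpoints, and slices with equal triangulations have
  heights differing by a constant multiple of \<open>n\<close>, even for a translation and odd for a
  reversal of all chords. Each diagonal has one lift in every height period of length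
  \<open>n\<close>, so counting removals becomes counting lattice points.\<close>

definition toggle :: "'a \<Rightarrow> 'a set \<Rightarrow> 'a set" where
  "toggle a S = (if a \<in> S then S - {a} else insert a S)"

definition symdiff :: "'a set \<Rightarrow> 'a set \<Rightarrow> 'a set" where
  "symdiff S D = (S - D) \<union> (D - S)"

text \<open>Leaving out the endpoint lets the traces of consecutive words concatenate without
  repetition. \<open>verts\<close> puts it back, as reversal of a walk requires.\<close>

fun trace :: "'a set \<Rightarrow> 'a list \<Rightarrow> 'a set list" where
  "trace S [] = []"
| "trace S (a # w) = S # trace (toggle a S) w"

definition verts :: "'a set \<Rightarrow> 'a list \<Rightarrow> 'a set list" where
  "verts S w = trace S w @ [fold toggle w S]"

lemma mem_symdiff: "p \<in> symdiff S D \<longleftrightarrow> (p \<in> S) \<noteq> (p \<in> D)"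
  unfolding symdiff_def by blast

lemma toggle_commute: "toggle a (toggle b S) = toggle b (toggle a S)"
  unfolding toggle_def by auto

lemma toggle_toggle [simp]: "toggle a (toggle a S) = S"
  unfolding toggle_def by auto

lemma toggle_symdiff: "toggle a (symdiff S D) = symdiff S (toggle a D)"
  unfolding toggle_def symdiff_def by auto

lemma fold_toggle_symdiff: "fold toggle w (symdiff S D) = symdiff S (fold toggle w D)"
  by (induction w arbitrary: D) (simp_all add: toggle_symdiff)

lemma trace_append: "trace S (u @ v) = trace S u @ trace (fold toggle u S) v"
  by (induction u arbitrary: S) simp_all

lemma trace_symdiff: "trace (symdiff S D) w = map (symdiff S) (trace D w)"
  by (induction w arbitrary: D) (simp_all add: toggle_symdiff)

lemma verts_symdiff: "verts (symdiff S D) w = map (symdiff S) (verts D w)"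
  unfolding verts_def by (simp add: trace_symdiff fold_toggle_symdiff)

lemma fold_toggle_toggle: "fold toggle w (toggle a S) = toggle a (fold toggle w S)"
  by (induction w arbitrary: S) (simp_all add: toggle_commute[of _ a])

lemma trace_toggle: "trace (toggle a S) w = map (toggle a) (trace S w)"
  by (induction w arbitrary: S) (simp_all add: toggle_commute[of _ a])

lemma fold_rev_toggle: "fold toggle (rev w) (fold toggle w S) = S"
  by (induction w arbitrary: S) (simp_all add: fold_toggle_toggle)

lemma verts_rev: "verts (fold toggle w S) (rev w) = rev (verts S w)"
proof (induction w arbitrary: S)
  case (Cons a w)
  then show ?case
    by (simp add: verts_def trace_append fold_rev_toggle)
qed (simp add: verts_def)

lemma verts_toggle: "verts (toggle a S) w = map (toggle a) (verts S w)"
  unfolding verts_def by (simp add: trace_toggle fold_toggle_toggle)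

lemma toggle_subset: "S \<subseteq> E \<Longrightarrow> a \<in> E \<Longrightarrow> toggle a S \<subseteq> E"
  unfolding toggle_def by auto

lemma trace_subset:
  assumes "S \<subseteq> E" "set w \<subseteq> E" "X \<in> set (trace S w)"
  shows "X \<subseteq> E"
  using assms
proof (induction w arbitrary: S)
  case (Cons a w)
  then show ?case using toggle_subset[of S E a] by auto
qed simp

lemma fold_toggle_subset: "S \<subseteq> E \<Longrightarrow> set w \<subseteq> E \<Longrightarrow> fold toggle w S \<subseteq> E"
  by (induction w arbitrary: S) (auto simp: toggle_subset)

lemma verts_subset: "S \<subseteq> E \<Longrightarrow> set w \<subseteq> E \<Longrightarrow> X \<in> set (verts S w) \<Longrightarrow> X \<subseteq> E"
  unfolding verts_def using trace_subset[of S E w X] fold_toggle_subset[of S E w] by auto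

lemma toggle_image:
  assumes "inj_on f E" "S \<subseteq> E" "a \<in> E"
  shows "toggle (f a) (f ` S) = f ` toggle a S"
  using assms inj_on_image_mem_iff[OF assms(1,3,2)] inj_on_image_set_diff[OF assms(1), of S "{a}"]
  unfolding toggle_def by auto

lemma trace_map:
  assumes "inj_on f E" "S \<subseteq> E" "set w \<subseteq> E"
  shows "trace (f ` S) (map f w) = map (image f) (trace S w)"
    and "fold toggle (map f w) (f ` S) = f ` fold toggle w S"
  using assms(2,3)
  by (induction w arbitrary: S) (simp_all add: toggle_image[OF assms(1)] toggle_subset)

lemma verts_map:
  assumes "inj_on f E" "S \<subseteq> E" "set w \<subseteq> E"
  shows "verts (f ` S) (map f w) = map (image f) (verts S w)"
  unfolding verts_def using trace_map[OF assms] by simp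

text \<open>Reflected Gray code: traverse the subsets without \<open>z\<close>, toggle
  \<open>z\<close>, and return along the same subsets with \<open>z\<close> added.\<close>

lemma gray_word:
  assumes "finite E"
  shows "\<exists>w. set w \<subseteq> E \<and> length w = 2 ^ card E - 1 \<and> distinct (verts {} w)"
  using assms
proof (induction E)
  case empty
  then show ?case by (simp add: verts_def)
next
  case (insert z E)
  then obtain w where w: "set w \<subseteq> E" "length w = 2 ^ card E - 1" "distinct (verts {} w)" by blast
  have sub: "X \<subseteq> E" if "X \<in> set (verts {} w)" for X using verts_subset[OF _ w(1) that] by simp
  have "verts {} (w @ z # rev w) = verts {} w @ verts (toggle z (fold toggle w {})) (rev w)"
    unfolding verts_def by (simp add: trace_append)
  also have "verts (toggle z (fold toggle w {})) (rev w) = map (toggle z) (rev (verts {} w))"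
    unfolding verts_toggle verts_rev ..
  finally have v: "verts {} (w @ z # rev w) = verts {} w @ map (toggle z) (rev (verts {} w))" .
  have "z \<notin> X \<and> z \<in> toggle z X" if "X \<in> set (verts {} w)" for X
    using sub[OF that] insert(2) unfolding toggle_def by auto
  moreover have "inj_on (toggle z) A" for A by (metis inj_onI toggle_toggle)
  ultimately have "distinct (verts {} (w @ z # rev w))"
    unfolding v using w(3) by (auto simp: distinct_map)
  moreover have "length (w @ z # rev w) = 2 ^ card (insert z E) - 1"
    using w(2) insert by (simp add: algebra_simps)
  ultimately show ?case using w(1) by (intro exI[of _ "w @ z # rev w"]) auto
qed

text \<open>
  Every letter \<open>a < m\<close> is conjugated by the \<open>a\<close>-th rotation of one word \<open>g\<close>, so all letters occur
  equally often. A visited set is an initial segment changed inside a rotated window. As the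
  letters of \<open>g\<close> are spaced by 3, two windows cannot cover three consecutive positions, which
  separates the initial segments.
\<close>

locale rotation =
  fixes m :: nat and g :: "nat list"
  assumes m_pos: "0 < m"
    and g_letters: "q \<in> set g \<Longrightarrow> q mod 3 = 2 \<and> q + 3 \<le> m"
    and g_distinct: "distinct (verts {} g)"
begin

definition sh :: "nat \<Rightarrow> nat \<Rightarrow> nat" where
  "sh a p = (a + p) mod m"

definition block :: "nat \<Rightarrow> nat list" where
  "block a = map (sh a) g @ [a] @ rev (map (sh a) g)"

definition V :: "nat set set" where "V = set (verts {} g)"

text \<open>The vertices available to \<open>block a\<close>. Excluding \<open>P = {}\<close> in the
  second part drops the endpoint \<open>{..<Suc a}\<close>, which is the starting vertex of the next
  block.\<close>

definition U :: "nat \<Rightarrow> nat set set" where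
  "U a = {symdiff {..<a} (sh a ` P) | P. P \<in> V} \<union>
    {symdiff {..<Suc a} (sh a ` P) | P. P \<in> V \<and> P \<noteq> {}}"

lemma V_letters: "P \<in> V \<Longrightarrow> q \<in> P \<Longrightarrow> q mod 3 = 2 \<and> q + 3 \<le> m"
  using verts_subset[of "{}" "set g" g P] g_letters unfolding V_def by blast

lemma sh_eq: "a < m \<Longrightarrow> q < m \<Longrightarrow> sh a q = (if a + q < m then a + q else a + q - m)"
  unfolding sh_def by (simp add: le_mod_geq)

lemma sh_mem:
  assumes "P \<in> V" "a < m" "p < m"
  shows "p \<in> sh a ` P \<longleftrightarrow> (if a \<le> p then p - a \<in> P else p + m - a \<in> P)"
proof -
  have "p = sh a q \<longleftrightarrow> q = (if a \<le> p then p - a else p + m - a)" if "q < m" for q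
    using assms that by (auto simp: sh_eq)
  moreover have "q < m" if "q \<in> P" for q using V_letters[OF assms(1) that] by simp
  ultimately have "p \<in> sh a ` P \<longleftrightarrow> (\<exists>q\<in>P. q = (if a \<le> p then p - a else p + m - a))"
    unfolding image_iff by blast
  then show ?thesis by simp
qed

lemma symdiff_block_eq:
  assumes P: "P \<in> V" and Q: "Q \<in> V" and ab: "a \<le> b" "b < m"
    and a': "a' = a \<or> a' = Suc a" and b': "b' = b \<or> b' = Suc b"
    and eq: "symdiff {..<a'} (sh a ` P) = symdiff {..<b'} (sh b ` Q)"
  shows "a = b \<and> a' = b' \<and> P = Q \<or> P = {} \<and> Q = {} \<and> a' = b'"
proof -
  have am: "a < m" using ab by simp
  \<comment> \<open>Membership of one position: the two segments agree at \<open>p\<close> iff the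
    two windows agree there. Every case below evaluates this at a few well-chosen positions.\<close>
  have E: "((p < a') = (p < b')) = ((if a \<le> p then p - a \<in> P else p + m - a \<in> P) =
      (if b \<le> p then p - b \<in> Q else p + m - b \<in> Q))" if "p < m" for p
  proof -
    have "p \<in> symdiff {..<a'} (sh a ` P) \<longleftrightarrow> p \<in> symdiff {..<b'} (sh b ` Q)" using eq by simp
    then show ?thesis
      unfolding mem_symdiff lessThan_iff sh_mem[OF P am that] sh_mem[OF Q ab(2) that] by argo
  qed
  have P3: "q \<in> P \<Longrightarrow> q mod 3 = 2 \<and> q + 3 \<le> m" for q using V_letters[OF P] .
  have Q3: "q \<in> Q \<Longrightarrow> q mod 3 = 2 \<and> q + 3 \<le> m" for q using V_letters[OF Q] .
  have n0: "0 \<notin> P" "0 \<notin> Q" "Suc 0 \<notin> P" using P3 Q3 by fastforce+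
  consider "a = b" | "b = Suc a" | "a + 2 \<le> b" using ab by linarith
  then show ?thesis
  proof cases
    case 1
    have "a' = b'" using E[of a] a' b' n0 1 ab by auto
    moreover have "p \<in> P \<longleftrightarrow> p \<in> Q" for p
    proof (cases "p < m")
      case True
      show ?thesis
      proof (cases "a + p < m")
        case True
        then show ?thesis using E[of "a + p"] \<open>a' = b'\<close> 1 by simp
      next
        case False
        then have "\<not> a \<le> a + p - m" "a + p - m + m - a = p" "a + p - m < m" using \<open>p < m\<close> am by auto
        then show ?thesis using E[of "a + p - m"] \<open>a' = b'\<close> 1 by simp
      qed
    next
      case False
      then show ?thesis using P3[of p] Q3[of p] by auto
    qed
    ultimately show ?thesis using 1 by blast
  next
    case 2
    \<comment> \<open>At \<open>a\<close> and \<open>a + 1\<close> the offsets are 0 and 1 in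
      \<open>P\<close>, and \<open>m - 1\<close> and 0 in \<open>Q\<close>; none of these is an
      admissible letter, so the segments agree at both positions and both end at
      \<open>a + 1\<close>.\<close>
    have mQ: "m - 1 \<notin> Q" using Q3[of "m - 1"] m_pos by auto
    have "a' = Suc a" using E[of a] a' b' n0 mQ 2 ab by auto
    moreover have "b' = b" using E[of b] a' b' n0 2 ab by auto
    ultimately have e: "(if a \<le> p then p - a \<in> P else p + m - a \<in> P) =
      (if Suc a \<le> p then p - Suc a \<in> Q else p + m - Suc a \<in> Q)" if "p < m" for p
      using E[OF that] 2 by simp
    \<comment> \<open>With equal segments the windows coincide, so the letters of \<open>Q\<close>
      are those of \<open>P\<close> lowered by one; consecutive numbers cannot both be 2 modulo
      3.\<close>
    have "P = {}"
    proof (rule equals0I)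
      fix q assume q: "q \<in> P"
      have "q < m" "0 < q" using P3[OF q] by (auto intro: gr0I)
      then have "q - 1 \<in> Q"
      proof (cases "a + q < m")
        case True
        then show ?thesis using e[of "a + q"] q \<open>0 < q\<close> by simp
      next
        case False
        then have "\<not> a \<le> a + q - m" "\<not> Suc a \<le> a + q - m" "a + q - m + m - a = q"
          "a + q - m + m - Suc a = q - 1" "a + q - m < m" using \<open>q < m\<close> am by auto
        then show ?thesis using e[of "a + q - m"] q by simp
      qed
      moreover obtain r where "q = Suc r" using \<open>0 < q\<close> gr0_conv_Suc by blast
      ultimately have "r mod 3 = 2" "Suc r mod 3 = 2" using P3[OF q] Q3 by simp_all
      then show False by (simp add: mod_Suc)
    qed
    moreover have "Q = {}"
    proof (rule equals0I)
      fix q assume q: "q \<in> Q"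
      have "q + 3 \<le> m" using Q3[OF q] by simp
      then show False
      proof (cases "a + 1 + q < m")
        case True
        then show ?thesis using e[of "a + 1 + q"] q \<open>P = {}\<close> by simp
      next
        case False
        then have "\<not> a \<le> a + 1 + q - m" "\<not> Suc a \<le> a + 1 + q - m" "a + 1 + q - m + m - Suc a = q" "a + 1 + q - m < m"
          using \<open>q + 3 \<le> m\<close> am by auto
        then show ?thesis using e[of "a + 1 + q - m"] q \<open>P = {}\<close> by simp
      qed
    qed
    ultimately show ?thesis using \<open>a' = Suc a\<close> \<open>b' = b\<close> 2 by simp
  next
    case 3
    \<comment> \<open>Position \<open>a + 1\<close> lies only in the longer segment and its offset 1
      is no letter of \<open>P\<close>, so the window of \<open>Q\<close> covers it. The bound
      \<open>q + 3 \<le> m\<close> then puts \<open>a + 3\<close> in the longer segment only as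
      well, but its offsets in \<open>P\<close> and \<open>Q\<close> are 0 and 1 modulo 3.\<close>
    have "a + 1 + m - b \<in> Q" using E[of "a + 1"] a' b' n0 3 ab by auto
    then have ge: "(a + 1 + m - b) mod 3 = 2" "a + 4 \<le> b" using Q3[of "a + 1 + m - b"] 3 ab by auto
    have "a + 3 + m - b \<in> Q \<or> 3 \<in> P" using E[of "a + 3"] a' b' ge(2) ab by auto
    then have False
    proof
      assume "a + 3 + m - b \<in> Q"
      then have "(a + 3 + m - b) mod 3 = 2" using Q3 by blast
      moreover have "a + 3 + m - b = Suc (Suc (a + 1 + m - b))" using ab by simp
      ultimately show False using ge(1) by (simp add: mod_Suc)
    qed (use P3 in fastforce)
    then show ?thesis ..
  qed
qed

lemma empty_in_V: "{} \<in> V"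
  unfolding V_def verts_def by (cases g) auto

lemma sh_inj: "a < m \<Longrightarrow> inj_on (sh a) {..<m}"
proof (rule inj_onI)
  fix x y assume *: "a < m" "x \<in> {..<m}" "y \<in> {..<m}" "sh a x = sh a y"
  then show "x = y" by (auto simp: sh_eq split: if_splits)
qed

text \<open>The second half of the block retraces the first with \<open>a\<close> toggled, so its
  net effect is to append \<open>a\<close> to the initial segment.\<close>

lemma trace_block:
  assumes "a < m"
  shows "fold toggle (block a) {..<a} = {..<Suc a}"
    and "distinct (trace {..<a} (block a))" "set (trace {..<a} (block a)) \<subseteq> U a"
proof -
  let ?h = "map (sh a) g"
  have gm: "set g \<subseteq> {..<m}" using g_letters by fastforce
  have sd: "symdiff S {} = S" for S :: "nat set" unfolding symdiff_def by simp
  have vh: "verts S ?h = map (\<lambda>P. symdiff S (sh a ` P)) (verts {} g)" for S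
    using verts_symdiff[of S "{}" ?h] verts_map[OF sh_inj[OF assms] _ gm, of "{}"] sd by simp
  have tog: "toggle a {..<a} = {..<Suc a}" unfolding toggle_def by auto
  show "fold toggle (block a) {..<a} = {..<Suc a}"
    unfolding block_def by (simp add: fold_toggle_toggle[symmetric] tog fold_rev_toggle)
  have tb: "trace S w = butlast (verts S w)" for S and w :: "nat list" unfolding verts_def by simp
  have "trace {..<a} (block a) = verts {..<a} ?h @ trace (fold toggle ?h {..<Suc a}) (rev ?h)"
    unfolding block_def verts_def by (simp add: trace_append fold_toggle_toggle[symmetric] tog)
  also have "trace (fold toggle ?h {..<Suc a}) (rev ?h) = rev (tl (verts {..<Suc a} ?h))"
    unfolding tb verts_rev by (simp add: butlast_rev)
  finally have t: "trace {..<a} (block a) = map (\<lambda>P. symdiff {..<a} (sh a ` P)) (verts {} g)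
      @ rev (map (\<lambda>P. symdiff {..<Suc a} (sh a ` P)) (tl (verts {} g)))"
    unfolding vh by (simp add: map_tl)
  have vg: "verts {} g = {} # tl (verts {} g)" unfolding verts_def by (cases g) auto
  have tl: "P \<in> V \<and> P \<noteq> {}" if "P \<in> set (tl (verts {} g))" for P
    using that vg g_distinct unfolding V_def by (metis distinct.simps(2) list.set_intros(2))
  have inj: "inj_on (\<lambda>P. symdiff {..<a'} (sh a ` P)) V" if "a' = a \<or> a' = Suc a" for a'
    using symdiff_block_eq[of _ _ a a a' a'] that assms by (intro inj_onI) blast
  have inj': "inj_on (\<lambda>P. symdiff {..<Suc a} (sh a ` P)) (set (tl (verts {} g)))"
    using inj[of "Suc a"] tl by (meson inj_on_subset subsetI)
  have dis: "symdiff {..<a} (sh a ` P) \<noteq> symdiff {..<Suc a} (sh a ` Q)" if "P \<in> V" "Q \<in> V" for P Q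
    using symdiff_block_eq[of P Q a a a "Suc a"] that assms by auto
  have "distinct (tl (verts {} g))" using g_distinct by (rule distinct_tl)
  then show "distinct (trace {..<a} (block a))"
    unfolding t using g_distinct inj inj' dis tl by (auto simp: distinct_map V_def)
  show "set (trace {..<a} (block a)) \<subseteq> U a"
    unfolding t U_def using tl by (auto simp: V_def)
qed

lemma U_disjoint:
  assumes "a < b" "b < m"
  shows "U a \<inter> U b = {}"
proof (rule ccontr)
  assume "U a \<inter> U b \<noteq> {}"
  then obtain X where X: "X \<in> U a" "X \<in> U b" by blast
  obtain a' P where P: "a' = a \<or> a' = Suc a \<and> P \<noteq> {}" "P \<in> V" "X = symdiff {..<a'} (sh a ` P)"
    using X(1) unfolding U_def by blast
  obtain b' Q where Q: "b' = b \<or> b' = Suc b \<and> Q \<noteq> {}" "Q \<in> V" "X = symdiff {..<b'} (sh b ` Q)"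
    using X(2) unfolding U_def by blast
  have "symdiff {..<a'} (sh a ` P) = symdiff {..<b'} (sh b ` Q)" using P(3) Q(3) by simp
  then have "a = b \<or> P = {} \<and> Q = {} \<and> a' = b'"
    using symdiff_block_eq[of P Q a b a' b'] P(1,2) Q(1,2) assms by fastforce
  then show False using P(1) Q(1) assms by auto
qed

text \<open>The full vertex of a cube is the start of the next one and must not be met early. It has
  the form required by \<open>symdiff_block_eq\<close>, with \<open>b = m - 1\<close>,
  \<open>b' = m\<close> and \<open>Q = {}\<close>.\<close>

lemma full_notin_U:
  assumes "a < m"
  shows "{..<m} \<notin> U a"
proof
  assume "{..<m} \<in> U a"
  then obtain a' P where P: "a' = a \<or> a' = Suc a \<and> P \<noteq> {}" "P \<in> V" "{..<m} = symdiff {..<a'} (sh a ` P)"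
    unfolding U_def by blast
  have "symdiff {..<m} (sh (m - 1) ` {}) = {..<m}" unfolding symdiff_def by simp
  then have "symdiff {..<a'} (sh a ` P) = symdiff {..<m} (sh (m - 1) ` {})" using P(3) by simp
  then have "P = {} \<and> a' = m \<or> a = m - 1 \<and> a' = m \<and> P = {}"
    using symdiff_block_eq[of P "{}" a "m - 1" a' m] empty_in_V P(1,2) assms by fastforce
  then show False using P(1) assms by auto
qed

definition word :: "nat \<Rightarrow> nat list" where
  "word k = concat (map block [0..<k])"

lemma word_Suc: "word (Suc k) = word k @ block k"
  unfolding word_def by simp

lemma trace_word:
  assumes "k \<le> m"
  shows "fold toggle (word k) {} = {..<k} \<and> distinct (trace {} (word k)) \<and>
    set (trace {} (word k)) \<subseteq> (\<Union>a<k. U a)"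
  using assms
proof (induction k)
  case (Suc k)
  then have *: "fold toggle (word k) {} = {..<k}" "distinct (trace {} (word k))"
    "set (trace {} (word k)) \<subseteq> (\<Union>a<k. U a)" by auto
  have "k < m" using Suc by simp
  note b = trace_block[OF this]
  have "(\<Union>a<k. U a) \<inter> U k = {}" using U_disjoint \<open>k < m\<close> by blast
  then show ?case using * b(2,3) unfolding word_Suc trace_append fold_append comp_def *(1) b(1)
    by (auto simp: lessThan_Suc)
qed (simp add: word_def)

text \<open>For fixed \<open>p\<close>, the map sending \<open>a\<close> to \<open>sh a p\<close>
  permutes \<open>{..<m}\<close>. This is what makes the combined word balanced.\<close>

lemma sum_shift_indicator:
  assumes "c < m"
  shows "(\<Sum>a<m. if sh a p = c then 1 else 0 :: nat) = 1"
proof -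
  define q where "q = p mod m"
  define a0 where "a0 = (if q \<le> c then c - q else c + m - q)"
  have q: "q < m" using m_pos unfolding q_def by simp
  have "sh a p = c \<longleftrightarrow> a = a0" if "a < m" for a
  proof -
    have "sh a p = sh a q" unfolding sh_def q_def by (simp add: mod_simps)
    then show ?thesis using q that assms unfolding a0_def by (auto simp: sh_eq)
  qed
  then have "(\<Sum>a<m. if sh a p = c then 1 else 0 :: nat) = (\<Sum>a<m. if a = a0 then 1 else 0)"
    by (intro sum.cong) auto
  moreover have "a0 < m" using q assms unfolding a0_def by auto
  ultimately show ?thesis by simp
qed

text \<open>Over all blocks, each letter of \<open>g\<close> is rotated onto \<open>c\<close> once,
  and every rotated copy of \<open>g\<close> is run forwards and backwards; the remaining 1 is the
  middle letter of \<open>block c\<close>.\<close>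

lemma count_word:
  assumes "c < m"
  shows "count_list (word m) c = 2 * length g + 1"
proof -
  have "count_list (word k) c = (\<Sum>a<k. 2 * count_list (map (sh a) g) c + (if a = c then 1 else 0))" for k
    by (induction k) (simp_all add: word_Suc block_def, simp add: word_def)
  moreover have "(\<Sum>a<m. count_list (map (sh a) h) c) = length h" for h
  proof (induction h)
    case (Cons p h)
    have "count_list (map (sh a) (p # h)) c = count_list (map (sh a) h) c + (if sh a p = c then 1 else 0)" for a
      by simp
    then have "(\<Sum>a<m. count_list (map (sh a) (p # h)) c) =
        (\<Sum>a<m. count_list (map (sh a) h) c) + (\<Sum>a<m. if sh a p = c then 1 else 0)"
      by (simp only: sum.distrib)
    then show ?case using Cons sum_shift_indicator[OF assms, of p] by simp
  qed simp
  ultimately show ?thesis using assms by (simp add: sum.distrib sum_distrib_left[symmetric])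
qed

lemma set_word: "set (word m) \<subseteq> {..<m}"
  using m_pos unfolding word_def block_def sh_def by auto

end

section \<open>Choice of the Gray code and transfer to an arbitrary coordinate set\<close>

lemma exists_word_lessThan:
  assumes m: "21 \<le> m" and s: "s \<le> 2 * m + 4"
  shows "\<exists>w. set w \<subseteq> {..<m} \<and> (\<forall>c<m. count_list w c = 2 * s + 1) \<and>
    distinct (trace {} w) \<and> fold toggle w {} = {..<m} \<and> {..<m} \<notin> set (trace {} w)"
proof -
  \<comment> \<open>The number of letters \<open>2, 5, ..., 3 * k - 1\<close> that respect the bound
    \<open>q + 3 \<le> m\<close>.\<close>
  define k where "k = (m - 2) div 3"
  define A where "A = (\<lambda>i. 3 * i + 2) ` {..<k}"
  have k: "6 \<le> k" "m \<le> 3 * k + 4" using m unfolding k_def by linarith+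
  have "card A = k" unfolding A_def by (subst card_image) (auto simp: inj_on_def)
  \<comment> \<open>Since \<open>m \<le> 3 * k + 4\<close>, the left side is at least
    \<open>2 * m + 4\<close> and hence at least \<open>s\<close>. The inequality first holds at
    \<open>k = 6\<close>.\<close>
  have "6 * k + 12 \<le> 2 ^ k - (1::nat)" using k(1)
  proof (induction k rule: dec_induct)
    case (step k)
    then have "(6 * k + 12) + 6 \<le> 2 * (2 ^ k - 1 :: nat)" by linarith
    then show ?case by simp
  qed simp
  then have sk: "s \<le> 2 ^ card A - 1" unfolding \<open>card A = k\<close> using s k by linarith
  obtain g0 where g0: "set g0 \<subseteq> A" "length g0 = 2 ^ card A - 1" "distinct (verts {} g0)"
    using gray_word[of A] unfolding A_def by blast
  \<comment> \<open>A prefix of a self-avoiding walk is self-avoiding, so every length up to that of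
    the Gray code is available.\<close>
  define g where "g = take s g0"
  have "g0 = g @ drop s g0" unfolding g_def by simp
  then have "trace {} g0 = trace {} g @ trace (fold toggle g {}) (drop s g0)" by (metis trace_append)
  then have g: "distinct (verts {} g)"
    using g0(3) \<open>g0 = g @ drop s g0\<close> unfolding verts_def by (cases "drop s g0") auto
  have gA: "set g \<subseteq> A" unfolding g_def using g0(1) set_take_subset by fast
  interpret rotation m g
  proof
    fix q assume "q \<in> set g"
    then obtain i where "q = 3 * i + 2" "i < k" using gA unfolding A_def by blast
    then show "q mod 3 = 2 \<and> q + 3 \<le> m" using m unfolding k_def by presburger
  qed (use m g in auto)
  have "length g = s" using sk g0(2) unfolding g_def by simp
  then show ?thesis
    using trace_word[of m] count_word set_word full_notin_U by (intro exI[of _ "word m"]) auto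
qed

text \<open>The bijection onto \<open>E\<close> is chosen to send the first or the last letter to
  \<open>b\<close>. Prescribing an end letter fixes the moves at which the even cycle will leave the
  tour.\<close>

lemma exists_word:
  assumes E: "finite E" "21 \<le> card E" and s: "s \<le> 2 * card E + 4" and b: "b \<in> E"
  shows "\<exists>w. set w \<subseteq> E \<and> (\<forall>c\<in>E. count_list w c = 2 * s + 1) \<and>
    distinct (trace {} w) \<and> fold toggle w {} = E \<and> E \<notin> set (trace {} w) \<and>
    (if first then hd w else last w) = b"
proof -
  let ?m = "card E"
  obtain w where w: "set w \<subseteq> {..<?m}" "\<forall>c<?m. count_list w c = 2 * s + 1"
    "distinct (trace {} w)" "fold toggle w {} = {..<?m}" "{..<?m} \<notin> set (trace {} w)"
    using exists_word_lessThan[OF E(2) s] by blast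
  have "w \<noteq> []" using w(2) E(2) by force
  define l where "l = (if first then hd w else last w)"
  have "l \<in> set w" unfolding l_def using \<open>w \<noteq> []\<close> by simp
  then have hw: "l < ?m" using w(1) by auto
  have "card ({..<?m} - {l}) = card (E - {b})" using hw b E(1) by simp
  then obtain f0 where f0: "bij_betw f0 ({..<?m} - {l}) (E - {b})"
    using finite_same_card_bij[of "{..<?m} - {l}" "E - {b}"] E(1) by auto
  define f where "f = f0(l := b)"
  have "bij_betw f ({..<?m} - {l}) (E - {b})"
    using f0 unfolding f_def by (rule bij_betw_cong[THEN iffD1, rotated]) simp
  then have "bij_betw f (({..<?m} - {l}) \<union> {l}) ((E - {b}) \<union> {f l})"
    by (intro notIn_Un_bij_betw) (auto simp: f_def)
  moreover have "({..<?m} - {l}) \<union> {l} = {..<?m}" "(E - {b}) \<union> {f l} = E"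
    using hw b by (auto simp: f_def)
  ultimately have f: "bij_betw f {..<?m} E" by simp
  have inj: "inj_on f {..<?m}" and im: "f ` {..<?m} = E" using f unfolding bij_betw_def by auto
  note tr = trace_map[OF inj _ w(1), of "{}", simplified]
  have sub: "X \<subseteq> {..<?m}" if "X \<in> set (trace {} w)" for X using trace_subset[OF _ w(1) that] by simp
  have "inj_on (image f) (set (trace {} w))"
    using inj_on_image_eq_iff[OF inj] sub by (intro inj_onI) (metis (no_types))
  then have d: "distinct (trace {} (map f w))" unfolding tr using w(3) by (simp add: distinct_map)
  have e: "E \<notin> set (trace {} (map f w))"
  proof
    assume "E \<in> set (trace {} (map f w))"
    then obtain X where X: "X \<in> set (trace {} w)" "f ` {..<?m} = f ` X" unfolding tr im by auto
    then have "{..<?m} = X" using inj_on_image_eq_iff[OF inj, of "{..<?m}" X] sub[OF X(1)] by simp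
    then show False using X(1) w(5) by simp
  qed
  have cnt: "count_list (map f v) (f x) = count_list v x" if "set v \<subseteq> {..<?m}" "x < ?m" for v x
    using that inj by (induction v) (auto simp: inj_on_eq_iff)
  have "count_list (map f w) c = 2 * s + 1" if "c \<in> E" for c
  proof -
    have "c \<in> f ` {..<?m}" using that unfolding im .
    then obtain x where "x < ?m" "c = f x" by blast
    then show ?thesis using cnt[OF w(1)] w(2) by simp
  qed
  moreover have "(if first then hd (map f w) else last (map f w)) = b"
    using \<open>w \<noteq> []\<close> unfolding f_def l_def by (auto simp: hd_map last_map)
  moreover have "set (map f w) \<subseteq> E"
    unfolding set_map using image_mono[OF w(1), of f] im by simp
  moreover have "fold toggle (map f w) {} = E" unfolding tr(2) w(4) im ..
  ultimately show ?thesis using d e by (intro exI[of _ "map f w"] conjI ballI)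
qed

section \<open>Slices and their triangulations\<close>

lemma crossing_sorted:
  assumes "a < c" "b < d"
  shows "crossing {a, c} {b, d} \<longleftrightarrow> a < b \<and> b < c \<and> c < d \<or> b < a \<and> a < d \<and> d < c"
  using assms unfolding crossing_def doubleton_eq_iff
  by (smt (verit, best) order.strict_trans not_less_iff_gr_or_eq)

lemma crossing_commute: "crossing e f \<longleftrightarrow> crossing f e"
  unfolding crossing_def by blast

locale ngon =
  fixes n :: nat
  assumes n6: "6 \<le> n"
begin

text \<open>
  \<open>chord i x\<close> joins \<open>x\<close> and \<open>x + i + 1\<close> modulo \<open>n\<close>. A slice picks a nested chain of such chords
  in the universal cover of the circle, one for each length; these are the triangulations without
  interior triangle. Raising \<open>f i\<close> by one, when the result is again a slice, is a flip.
\<close>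

definition chord :: "nat \<Rightarrow> int \<Rightarrow> nat set" where
  "chord i x = {nat (x mod int n), nat ((x + int i + 1) mod int n)}"

definition slice :: "(nat \<Rightarrow> int) \<Rightarrow> bool" where
  "slice f \<longleftrightarrow> (\<forall>i. 1 \<le> i \<and> i < n - 3 \<longrightarrow> f (Suc i) = f i \<or> f (Suc i) = f i - 1)"

definition tri :: "(nat \<Rightarrow> int) \<Rightarrow> nat set set" where
  "tri f = {chord i (f i) | i. 1 \<le> i \<and> i \<le> n - 3}"

section \<open>Lifts of chords, and crossings in cyclic order\<close>

lemma chord_shift: "chord i (x + k * int n) = chord i x"
proof -
  have "x + k * int n + int i + 1 = (x + int i + 1) + k * int n" by simp
  then show ?thesis unfolding chord_def by (metis mod_mult_self1)
qed

text \<open>The complementary arc gives the same endpoints: \<open>i\<close> vertices lie strictly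
  on one side of the chord and \<open>n - 2 - i\<close> on the other.\<close>

lemma chord_reverse:
  assumes "i \<le> n - 2"
  shows "chord (n - 2 - i) (x + int i + 1) = chord i x"
proof -
  have "x + int i + 1 + int (n - 2 - i) + 1 = x + int n" using assms n6 by simp
  then show ?thesis unfolding chord_def by (simp add: insert_commute)
qed

lemma residue_cases:
  fixes x a :: int
  assumes "0 \<le> a" "a < int n"
  shows "(x + a) mod int n = x mod int n + a \<and> x mod int n + a < int n
    \<or> (x + a) mod int n = x mod int n + a - int n \<and> int n \<le> x mod int n + a"
proof -
  have x: "0 \<le> x mod int n" "x mod int n < int n" using n6 by simp_all
  have "(x + a) mod int n = (x mod int n + a) mod int n" by (simp add: mod_simps)
  also have "\<dots> = (if x mod int n + a < int n then x mod int n + a else x mod int n + a - int n)"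
    using x assms by (smt (verit) mod_pos_pos_trivial mod_add_self2 minus_mod_self2)
  finally show ?thesis by auto
qed

text \<open>\<open>crossing\<close> compares labels linearly, so the cases record between which of
  the four cyclically ordered endpoints the labels wrap around to 0.\<close>

lemma crossing_arc:
  assumes "0 < a" "a < l" "l < b" "b < int n"
  shows "crossing {nat (x mod int n), nat ((x + l) mod int n)}
    {nat ((x + a) mod int n), nat ((x + b) mod int n)}"
proof -
  define y where "y = x mod int n"
  define xa where "xa = (x + a) mod int n"
  define xb where "xb = (x + b) mod int n"
  define xl where "xl = (x + l) mod int n"
  note defs = y_def[symmetric] xa_def[symmetric] xb_def[symmetric] xl_def[symmetric]
  have x: "0 \<le> y" "y < int n" using n6 by (simp_all add: y_def)
  have sw: "{p, q} = {q, p}" for p q :: nat by blast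
  note cr = residue_cases[of l x, unfolded defs] residue_cases[of a x, unfolded defs]
    residue_cases[of b x, unfolded defs]
  consider "y + b < int n" | "y + l < int n" "int n \<le> y + b"
    | "y + a < int n" "int n \<le> y + l" | "int n \<le> y + a" by linarith
  then show ?thesis
  proof cases
    case 1
    then show ?thesis unfolding defs using cr x assms
      by (subst crossing_sorted) auto
  next
    case 2
    then show ?thesis unfolding defs using cr x assms
      by (subst sw[of "nat xa"], subst crossing_sorted) auto
  next
    case 3
    then show ?thesis unfolding defs using cr x assms
      by (subst sw[of "nat xa"], subst sw[of "nat y"],
        subst crossing_sorted) auto
  next
    case 4
    then show ?thesis unfolding defs using cr x assms
      by (subst sw[of "nat y"], subst crossing_sorted) auto
  qed
qed

lemma not_crossing_nested:
  assumes "0 \<le> a" "a < b" "b \<le> l" "l < int n"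
  shows "\<not> crossing {nat (x mod int n), nat ((x + l) mod int n)}
    {nat ((x + a) mod int n), nat ((x + b) mod int n)}"
proof -
  define y where "y = x mod int n"
  define xa where "xa = (x + a) mod int n"
  define xb where "xb = (x + b) mod int n"
  define xl where "xl = (x + l) mod int n"
  note defs = y_def[symmetric] xa_def[symmetric] xb_def[symmetric] xl_def[symmetric]
  have x: "0 \<le> y" "y < int n" using n6 by (simp_all add: y_def)
  have sw: "{p, q} = {q, p}" for p q :: nat by blast
  note cr = residue_cases[of l x, unfolded defs] residue_cases[of a x, unfolded defs]
    residue_cases[of b x, unfolded defs]
  consider "y + l < int n" | "y + b < int n" "int n \<le> y + l"
    | "y + a < int n" "int n \<le> y + b" | "int n \<le> y + a" by linarith
  then show ?thesis
  proof cases
    case 1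
    then show ?thesis unfolding defs using cr x assms
      by (subst crossing_sorted) auto
  next
    case 2
    then show ?thesis unfolding defs using cr x assms
      by (subst sw[of "nat y"], subst crossing_sorted) auto
  next
    case 3
    then show ?thesis unfolding defs using cr x assms
      by (subst sw[of "nat xa"], subst sw[of "nat y"],
        subst crossing_sorted) auto
  next
    case 4
    then show ?thesis unfolding defs using cr x assms
      by (subst sw[of "nat y"], subst crossing_sorted) auto
  qed
qed

lemma slice_nested:
  assumes "slice f" "1 \<le> i" "i \<le> j" "j \<le> n - 3"
  shows "f j \<le> f i \<and> f i + int i \<le> f j + int j"
  using assms(3,4)
proof (induction j rule: dec_induct)
  case (step j)
  then have "f (Suc j) = f j \<or> f (Suc j) = f j - 1"
    using assms(1,2) unfolding slice_def by auto
  then show ?case using step by auto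
qed simp

lemma tri_noncrossing:
  assumes "slice f"
  shows "noncrossing (tri f)"
proof -
  have *: "\<not> crossing (chord j (f j)) (chord i (f i))" if "1 \<le> i" "i \<le> j" "j \<le> n - 3" for i j
  proof -
    have "f j \<le> f i" "f i + int i \<le> f j + int j" using slice_nested[OF assms] that by auto
    then show ?thesis
      using not_crossing_nested[of "f i - f j" "f i - f j + int i + 1" "int j + 1" "f j"] that n6
      unfolding chord_def by (simp add: add.assoc)
  qed
  show ?thesis unfolding noncrossing_def tri_def
    using * crossing_commute by (auto, metis nat_le_linear)
qed

section \<open>Maximality: slices are triangulations\<close>

lemma side_iff:
  assumes "u < n" "v < n"
  shows "{u, v} \<in> sides n \<longleftrightarrow> v = Suc u mod n \<or> u = Suc v mod n"
  using assms unfolding sides_def by (auto simp: doubleton_eq_iff)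

lemma chord_in_sides: "chord 0 x \<in> sides n"
proof -
  define u where "u = nat (x mod int n)"
  define v where "v = nat ((x + 1) mod int n)"
  have uv: "int u = x mod int n" "int v = (x + 1) mod int n" "u < n" "v < n"
    using n6 unfolding u_def v_def by (auto simp: nat_less_iff)
  have d: "v = u + 1 \<or> u + 1 = v + n" using residue_cases[of 1 x] uv n6 by linarith
  have "v = Suc u mod n" using d uv(3,4) by auto
  then have "{u, v} \<in> sides n" using uv(3,4) by (simp add: side_iff)
  then show ?thesis unfolding chord_def u_def v_def by simp
qed

lemma chord_in_diagonals:
  assumes "1 \<le> i" "i \<le> n - 3"
  shows "chord i x \<in> diagonals n"
proof -
  let ?x = "x mod int n"
  have x: "0 \<le> ?x" "?x < int n" using n6 by simp_all
  have r: "(x + int i + 1) mod int n = ?x + int i + 1 \<and> ?x + int i + 1 < int n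
    \<or> (x + int i + 1) mod int n = ?x + int i + 1 - int n \<and> int n \<le> ?x + int i + 1"
    using residue_cases[of "int i + 1" x] assms n6 by (auto simp: add.assoc)
  define u where "u = nat ?x"
  define v where "v = nat ((x + int i + 1) mod int n)"
  have uv: "int u = ?x" "int v = (x + int i + 1) mod int n" "u < n" "v < n"
    using n6 unfolding u_def v_def by (auto simp: nat_less_iff)
  have d: "v = u + i + 1 \<or> u + i + 1 = v + n" using r uv by linarith
  have "Suc a mod n = (if Suc a = n then 0 else Suc a)" if "a < n" for a using that by auto
  then have "{u, v} \<notin> sides n" using d uv(3,4) assms n6 by (auto simp: side_iff split: if_splits)
  moreover have "u \<noteq> v" using d uv(3,4) assms n6 by auto
  ultimately show ?thesis unfolding diagonals_def chord_def u_def[symmetric] v_def[symmetric]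
    using uv(3,4) by blast
qed

text \<open>\<open>p i w\<close> is the offset of \<open>w\<close> from the start of the
  \<open>i\<close>-th chord. Take the least \<open>i\<close> whose arc contains both endpoints of
  \<open>e\<close>. For \<open>i > 1\<close> the previous arc misses one endpoint, the only vertex
  gained; the other one lies strictly inside it, since otherwise \<open>e\<close> would be a side or
  the \<open>i\<close>-th chord. So \<open>e\<close> crosses the previous chord. If the longest arc
  already misses an endpoint, the longest chord is crossed for the same reason.\<close>

lemma tri_maximal:
  assumes f: "slice f" and e: "e \<in> diagonals n" "e \<notin> tri f"
  shows "\<exists>c\<in>tri f. crossing c e"
proof -
  obtain u v where uv: "e = {u, v}" "u < n" "v < n" "u \<noteq> v" "{u, v} \<notin> sides n"
    using e(1) unfolding diagonals_def by blast
  define p where "p i w = (int w - f i) mod int n" for i w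
  have p: "0 \<le> p i w" "p i w < int n" for i w unfolding p_def using n6 by simp_all
  have w: "w = nat ((f i + p i w) mod int n)" if "w < n" for i w
    using that unfolding p_def by (simp add: mod_simps)
  have cross: ?thesis if i: "1 \<le> i" "i \<le> n - 3" and ab: "a < n" "b < n" "e = {a, b}"
    "0 < p i a" "p i a < int i + 1" "int i + 1 < p i b" for i a b
  proof -
    have "crossing (chord i (f i)) e"
      using crossing_arc[of "p i a" "int i + 1" "p i b" "f i"] i ab w[of a i] w[of b i] p
      unfolding chord_def by (simp add: add.assoc)
    then show ?thesis using i unfolding tri_def by blast
  qed
  have side: "{a, b} \<in> sides n" if "a < n" "b < n" "(int b - int a) mod int n = 1" for a b
  proof -
    have "int b = (int a + 1) mod int n"
    proof -
      have "(int a + 1) mod int n = (int a + (int b - int a)) mod int n"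
        using that(3) by (metis mod_add_right_eq)
      then show ?thesis using that(2) by simp
    qed
    then have "int b = int (Suc a mod n)" by (simp add: zmod_int add.commute)
    then show ?thesis unfolding side_iff[OF that(1,2)] by linarith
  qed
  have inj: "a = b" if "a < n" "b < n" "p i a = p i b" for i a b
    using w[OF that(1), of i] w[OF that(2), of i] that(3) by metis
  have ends: "{a, b} = chord i (f i)" if "a < n" "b < n" "p i a = 0" "p i b = int i + 1" for i a b
  proof -
    have "a = nat (f i mod int n)" "b = nat ((f i + int i + 1) mod int n)"
      using w[OF that(1), of i] w[OF that(2), of i] unfolding that(3,4) by (simp_all only: add_0_right add.assoc)
    then show ?thesis unfolding chord_def by blast
  qed
  have diff: "(int b - int a) mod int n = (p i b - p i a) mod int n" for a b i
    unfolding p_def by (simp add: mod_simps)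
  \<comment> \<open>Offsets that are cyclically consecutive, including the wrap from
    \<open>n - 1\<close> to 0, would make \<open>e\<close> a side.\<close>
  have up: "p i b - p i a \<noteq> 1" "p i b - p i a \<noteq> 1 - int n" if "a < n" "b < n" "e = {a, b}" for a b i
  proof -
    have "(1 - int n) mod int n = 1" "1 mod int n = 1" using n6 by simp_all
    then show "p i b - p i a \<noteq> 1" "p i b - p i a \<noteq> 1 - int n"
      using side[OF that(1,2), unfolded diff[of b a i]] that(3) uv(1,5) by auto
  qed
  have nochord: "\<not> (p i a = 0 \<and> p i b = int i + 1)" if "1 \<le> i" "i \<le> n - 3" "a < n" "b < n" "e = {a, b}" for i a b
    using ends[of a b i] that e(2) unfolding tri_def by blast
  define P where "P i \<longleftrightarrow> p i u \<le> int i + 1 \<and> p i v \<le> int i + 1" for i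
  show ?thesis
  proof (cases "P (n - 3)")
    case False
    have "?thesis" if "p (n - 3) b > int (n - 3) + 1" "a < n" "b < n" "a \<noteq> b" "e = {a, b}" for a b
    proof -
      have b: "p (n - 3) b = int n - 1" using that(1) p(2)[of "n - 3" b] n6 by simp
      have "p (n - 3) a \<noteq> int n - 1" using inj[of a b "n - 3"] that b by auto
      moreover have "p (n - 3) a \<noteq> 0" "p (n - 3) a \<noteq> int n - 2"
        using up[of b a "n - 3"] up[of a b "n - 3"] that b by (auto simp: insert_commute)
      ultimately show ?thesis using cross[of "n - 3" a b] b that p[of "n - 3" a] n6 by simp
    qed
    from this[of v u] this[of u v] False uv show ?thesis unfolding P_def by fastforce
  next
    case True
    define i where "i = (LEAST i. 1 \<le> i \<and> P i)"
    have i: "1 \<le> i" "P i" "i \<le> n - 3"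
      using LeastI[of "\<lambda>i. 1 \<le> i \<and> P i" "n - 3"] Least_le[of "\<lambda>i. 1 \<le> i \<and> P i" "n - 3"] True n6
      unfolding i_def by auto
    show ?thesis
    proof (cases "i = 1")
      case True
      have "p i u \<le> 2" "p i v \<le> 2" using i(2) True unfolding P_def by auto
      then consider "p i u = p i v" | "p i u - p i v = 1" | "p i v - p i u = 1"
        | "p i u = 0" "p i v = 2" | "p i v = 0" "p i u = 2"
        using p(1)[of i u] p(1)[of i v] by linarith
      then show ?thesis
        using inj[of u v i] up[of u v i] up[of v u i] nochord[of i u v] nochord[of i v u] uv(1-4) i(1,3) True
        by cases (auto simp: insert_commute)
    next
      case False
      define j where "j = i - 1"
      have j: "1 \<le> j" "j \<le> n - 3" "i = Suc j" using i False unfolding j_def by auto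
      have nP: "\<not> P j"
        using not_less_Least[of j "\<lambda>i. 1 \<le> i \<and> P i"] j i_def by auto
      have fi: "f i = f j \<or> f i = f j - 1" using f j i unfolding slice_def by auto
      \<comment> \<open>The arc grows by a vertex at its end, which keeps all offsets, or at its
        start, which raises them cyclically by one.\<close>
      have pi: "p i w = (if f i = f j then p j w else if p j w = int n - 1 then 0 else p j w + 1)" for w
      proof (cases "f i = f j")
        case False
        then have "int w - f i = (int w - f j) + 1" using fi by simp
        then have e: "p i w = (int w - f j + 1) mod int n" unfolding p_def by (rule arg_cong)
        show ?thesis
          using residue_cases[of 1 "int w - f j", folded p_def e] p[of j w] p[of i w] False n6
          by auto
      qed (simp add: p_def)
      have ?thesis if ab: "p j b > int j + 1" "a < n" "b < n" "a \<noteq> b" "e = {a, b}" for a b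
      proof -
        have le: "p i a \<le> int j + 2" "p i b \<le> int j + 2" using i(2) ab(5) uv(1) j(3)
          unfolding P_def by (auto simp: doubleton_eq_iff)
        have ne: "p j a \<noteq> p j b" using inj ab by blast
        note u1 = up[OF ab(2,3,5), of j] up[of b a j]
        note nc = nochord[OF i(1,3), of a b] nochord[OF i(1,3), of b a]
        have "0 < p j a \<and> p j a < int j + 1"
          using le ne u1 nc pi[of a] pi[of b] p[of j a] p[of j b] ab j
          by (auto simp: insert_commute split: if_splits)
        then show ?thesis using cross[OF j(1,2) ab(2,3,5)] ab(1) by simp
      qed
      from this[of v u] this[of u v] nP uv show ?thesis unfolding P_def by fastforce
    qed
  qed
qed

lemma tri_triangulation:
  assumes "slice f"
  shows "triangulation n (tri f)"
proof -
  have "S = tri f" if S: "tri f \<subseteq> S" "S \<subseteq> diagonals n" "noncrossing S" for S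
    using tri_maximal[OF assms] S unfolding noncrossing_def by (metis subset_antisym subset_iff)
  then show ?thesis
    using tri_noncrossing[OF assms] chord_in_diagonals
    unfolding triangulation_def tri_def by auto
qed

section \<open>Coincidences between chords, flips, and slices with equal triangulations\<close>

lemma nat_mod_eq_iff: "nat (x mod int n) = nat (y mod int n) \<longleftrightarrow> int n dvd x - y"
  using n6 by (simp add: eq_nat_nat_iff mod_eq_dvd_iff)

lemma dvd_small: "int n dvd z \<Longrightarrow> \<bar>z\<bar> < int n \<Longrightarrow> z = 0"
  using zdvd_not_zless[of "\<bar>z\<bar>" "int n"] by (cases "z = 0") auto

lemma chord_eq_iff:
  assumes "1 \<le> i" "i \<le> n - 3" "1 \<le> j" "j \<le> n - 3"
  shows "chord i x = chord j y \<longleftrightarrow>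
    i = j \<and> int n dvd y - x \<or> j = n - 2 - i \<and> int n dvd y - (x + int i + 1)"
proof
  assume "chord i x = chord j y"
  then consider "int n dvd x - y" "int n dvd (x + int i + 1) - (y + int j + 1)"
    | "int n dvd x - (y + int j + 1)" "int n dvd (x + int i + 1) - y"
    unfolding chord_def doubleton_eq_iff nat_mod_eq_iff by blast
  then show "i = j \<and> int n dvd y - x \<or> j = n - 2 - i \<and> int n dvd y - (x + int i + 1)"
  proof cases
    case 1
    then have "int n dvd int i - int j"
      using dvd_diff[OF 1(2) 1(1)] by (simp add: algebra_simps)
    then have "i = j" using dvd_small[of "int i - int j"] assms n6 by auto
    then show ?thesis using 1 by (metis dvd_minus_iff minus_diff_eq)
  next
    case 2
    have "int n dvd int i + int j + 2"
      using dvd_diff[OF 2(2) 2(1)] by (simp add: algebra_simps)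
    then have "int n dvd int i + int j + 2 - int n" by simp
    then have "int i + int j + 2 - int n = 0" using dvd_small[of "int i + int j + 2 - int n"] assms n6 by auto
    then have "j = n - 2 - i" by linarith
    then show ?thesis using 2 by (metis dvd_minus_iff minus_diff_eq)
  qed
next
  assume "i = j \<and> int n dvd y - x \<or> j = n - 2 - i \<and> int n dvd y - (x + int i + 1)"
  then show "chord i x = chord j y"
  proof
    assume "i = j \<and> int n dvd y - x"
    then obtain k where "i = j" "y = x + k * int n" by (metis add_diff_cancel_left' diff_add_cancel dvd_def mult.commute add.commute)
    then show ?thesis by (simp add: chord_shift)
  next
    assume *: "j = n - 2 - i \<and> int n dvd y - (x + int i + 1)"
    then obtain k where "y - (x + int i + 1) = int n * k" by (elim conjE dvdE)
    then have "y = (x + int i + 1) + k * int n" by (simp add: algebra_simps)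
    then show ?thesis using * chord_reverse[of i x] assms by (simp add: chord_shift)
  qed
qed

text \<open>For \<open>i < j\<close> a repetition could only be a reversal, so \<open>n\<close>
  would divide \<open>f j - (f i + int i + 1)\<close>; nesting places this number strictly between
  \<open>- n\<close> and 0.\<close>

lemma chord_inj_on_slice:
  assumes "slice f" "1 \<le> i" "i \<le> n - 3" "1 \<le> j" "j \<le> n - 3" "chord i (f i) = chord j (f j)"
  shows "i = j"
proof -
  have *: False if "1 \<le> i" "i < j" "j \<le> n - 3" "chord i (f i) = chord j (f j)" for i j
  proof -
    have "f j \<le> f i" "f i + int i \<le> f j + int j" using slice_nested[OF assms(1)] that by auto
    moreover have "int n dvd f j - (f i + int i + 1)" using chord_eq_iff[of i j] that by auto
    ultimately show False using dvd_small[of "f j - (f i + int i + 1)"] that n6 by linarith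
  qed
  show ?thesis using *[of i j] *[of j i] assms by (metis linorder_neqE_nat)
qed

lemma quadrilateral_flip:
  assumes "triangulation n T" "triangulation n T'" "{a, c} \<in> T" "T' = insert {b, d} (T - {{a, c}})"
    "a \<noteq> b" "a \<noteq> c" "b \<noteq> c" "a \<noteq> d" "c \<noteq> d" "b \<noteq> d"
    "{a, b} \<in> T \<union> sides n" "{b, c} \<in> T \<union> sides n" "{a, d} \<in> T \<union> sides n" "{c, d} \<in> T \<union> sides n"
  shows "flip n T {a, c} T'"
proof -
  have "{d, c} \<in> T \<union> sides n" using assms by (simp add: insert_commute)
  then have "triangle_of n T a b c" "triangle_of n T a d c"
    using assms unfolding triangle_of_def by simp_all
  then show ?thesis using assms unfolding flip_def by blast
qed

text \<open>With \<open>x = f i\<close> the quadrilateral has corners \<open>x\<close>,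
  \<open>x + 1\<close>, \<open>x + i + 1\<close>, \<open>x + i + 2\<close>. That both slices are
  legal forces column \<open>i - 1\<close> to be at \<open>x + 1\<close> and column
  \<open>i + 1\<close> at \<open>x\<close>; these chords are two of its sides and degenerate to
  polygon sides at the ends of the chain.\<close>

lemma tri_flip_up:
  assumes f: "slice f" and g: "slice (f(i := f i + 1))" and i: "1 \<le> i" "i \<le> n - 3"
  shows "flip n (tri f) (chord i (f i)) (tri (f(i := f i + 1)))"
    and "flip n (tri (f(i := f i + 1))) (chord i (f i + 1)) (tri f)"
    and "tri (f(i := f i + 1)) = insert (chord i (f i + 1)) (tri f - {chord i (f i)})"
    and "chord i (f i + 1) \<notin> tri f"
proof -
  let ?g = "f(i := f i + 1)" and ?x = "f i"
  define a where "a = nat (?x mod int n)"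
  define b where "b = nat ((?x + 1) mod int n)"
  define c where "c = nat ((?x + int i + 1) mod int n)"
  define d where "d = nat ((?x + int i + 2) mod int n)"
  have ch: "{a, b} = chord 0 ?x" "{a, c} = chord i ?x" "{b, c} = chord (i - 1) (?x + 1)"
    "{a, d} = chord (Suc i) ?x" "{c, d} = chord 0 (?x + int i + 1)" "{b, d} = chord i (?x + 1)"
    using i unfolding a_def b_def c_def d_def chord_def by (simp_all add: algebra_simps of_nat_diff)
  have dist: "a \<noteq> b" "a \<noteq> c" "b \<noteq> c" "a \<noteq> d" "c \<noteq> d" "b \<noteq> d"
    using i n6 dvd_small unfolding a_def b_def c_def d_def nat_mod_eq_iff by fastforce+
  have ne: "chord i ?x \<noteq> chord i (?x + 1)"
    using chord_eq_iff[of i i ?x "?x + 1"] i n6 dvd_small[of 1] nat_dvd_not_less[of i n] by auto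
  have lo: "chord (i - 1) (?x + 1) \<in> sides n \<or> (\<exists>j. j \<noteq> i \<and> 1 \<le> j \<and> j \<le> n - 3 \<and> chord (i - 1) (?x + 1) = chord j (f j))"
  proof (cases "i = 1")
    case False
    then obtain j where j: "i = Suc j" "1 \<le> j" using i by (cases i) auto
    then have "f j = ?x + 1" using f[unfolded slice_def, rule_format, of j]
      g[unfolded slice_def, rule_format, of j] i by auto
    then show ?thesis using j i by (intro disjI2 exI[of _ j]) auto
  qed (simp add: chord_in_sides)
  have hi: "chord (Suc i) ?x \<in> sides n \<or> (\<exists>j. j \<noteq> i \<and> 1 \<le> j \<and> j \<le> n - 3 \<and> chord (Suc i) ?x = chord j (f j))"
  proof (cases "i = n - 3")
    case True
    then have "Suc i = n - 2 - 0" using n6 by simp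
    then show ?thesis using chord_reverse[of 0 "?x - 1"] chord_in_sides[of "?x - 1"] by simp
  next
    case False
    then have "f (Suc i) = ?x" using f[unfolded slice_def, rule_format, of i]
      g[unfolded slice_def, rule_format, of i] i by auto
    then show ?thesis using False i by (intro disjI2 exI[of _ "Suc i"]) auto
  qed
  show new: "chord i (?x + 1) \<notin> tri f"
  proof
    assume "chord i (?x + 1) \<in> tri f"
    then obtain j where j: "1 \<le> j" "j \<le> n - 3" "chord j (f j) = chord i (?x + 1)" unfolding tri_def by auto
    then have "j \<noteq> i" using ne by auto
    then show False using chord_inj_on_slice[OF g i j(1,2)] j(3) by auto
  qed
  show tg: "tri ?g = insert (chord i (?x + 1)) (tri f - {chord i ?x})"
  proof -
    have im: "tri h = (\<lambda>j. chord j (h j)) ` {1..n - 3}" for h unfolding tri_def by auto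
    have I: "{1..n - 3} = insert i ({1..n - 3} - {i})" using i by auto
    have inj: "inj_on (\<lambda>j. chord j (f j)) {1..n - 3}"
      using chord_inj_on_slice[OF f] by (intro inj_onI) auto
    have "tri ?g = insert (chord i (?x + 1)) ((\<lambda>j. chord j (?g j)) ` ({1..n - 3} - {i}))"
      unfolding im by (subst I) (simp only: image_insert fun_upd_same)
    also have "(\<lambda>j. chord j (?g j)) ` ({1..n - 3} - {i}) = (\<lambda>j. chord j (f j)) ` ({1..n - 3} - {i})"
      by (intro image_cong) auto
    also have "\<dots> = tri f - {chord i ?x}"
      unfolding im using inj_on_image_set_diff[OF inj, of "{1..n - 3}" "{i}"] i by simp
    finally show ?thesis .
  qed
  have tf: "tri f = insert (chord i ?x) (tri ?g - {chord i (?x + 1)})"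
    unfolding tg using i new by (auto simp: tri_def)
  have other: "chord j (f j) \<in> tri f \<inter> tri ?g" if "j \<noteq> i" "1 \<le> j" "j \<le> n - 3" for j
  proof -
    have "chord j (f j) = chord j (?g j)" using that by simp
    then show ?thesis using that unfolding tri_def by blast
  qed
  have lo': "chord (i - 1) (?x + 1) \<in> sides n \<or> chord (i - 1) (?x + 1) \<in> tri f \<inter> tri ?g"
    using lo other by metis
  have hi': "chord (Suc i) ?x \<in> sides n \<or> chord (Suc i) ?x \<in> tri f \<inter> tri ?g"
    using hi other by metis
  have in': "chord i ?x \<in> tri f" "chord i (?x + 1) \<in> tri ?g" using i tg unfolding tri_def by auto
  show "flip n (tri f) (chord i ?x) (tri ?g)"
    unfolding ch(2)[symmetric]
  proof (rule quadrilateral_flip[OF tri_triangulation[OF f] tri_triangulation[OF g], of a c b d])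
    show "tri ?g = insert {b, d} (tri f - {{a, c}})" unfolding ch tg ..
    show "{a, c} \<in> tri f" unfolding ch by (rule in')
    show "{a, b} \<in> tri f \<union> sides n" "{b, c} \<in> tri f \<union> sides n" "{a, d} \<in> tri f \<union> sides n"
      "{c, d} \<in> tri f \<union> sides n"
      using lo' hi' chord_in_sides unfolding ch by blast+
  qed (fact dist)+
  show "flip n (tri ?g) (chord i (?x + 1)) (tri f)"
    unfolding ch(6)[symmetric]
  proof (rule quadrilateral_flip[OF tri_triangulation[OF g] tri_triangulation[OF f], of b d a c])
    show "tri f = insert {a, c} (tri ?g - {{b, d}})" unfolding ch by (rule tf)
    show "{b, d} \<in> tri ?g" unfolding ch by (rule in')
    show "{b, a} \<in> tri ?g \<union> sides n" "{a, d} \<in> tri ?g \<union> sides n" "{b, c} \<in> tri ?g \<union> sides n"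
      "{d, c} \<in> tri ?g \<union> sides n"
      using lo' hi' chord_in_sides unfolding insert_commute[of b a] insert_commute[of d c] ch by blast+
  qed (fact dist dist[symmetric])+
qed

text \<open>The colour of a flip can be read off its two triangulations, so a step of a cycle is
  counted for one diagonal only.\<close>

lemma flip_unique:
  assumes "flip n T e T'" "T' = insert b (T - {a})" "a \<in> T" "b \<notin> T"
  shows "e = a"
proof (rule ccontr)
  assume "e \<noteq> a"
  have "e \<in> T \<and> (\<exists>c. T' = insert c (T - {e}))"
    using assms(1) unfolding flip_def by (elim conjE exE) (intro conjI exI)
  then obtain c where "e \<in> T" "T' = insert c (T - {e})" by (elim conjE exE)
  moreover from this have "c = e" using \<open>e \<noteq> a\<close> assms(2) by auto
  ultimately have "T' = T" by blast
  then show False using assms(2,4) by blast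
qed

text \<open>In the first column where the slices part they would use chords of equal length shifted
  by one vertex, and these cross.\<close>

lemma slice_determined:
  assumes f: "slice f" and g: "slice g" and eq: "tri f = tri g" and one: "g 1 = f 1"
    and i: "1 \<le> i" "i \<le> n - 3"
  shows "g i = f i"
  using i
proof (induction i rule: dec_induct)
  case (step i)
  have no: "\<not> (f' (Suc i) = f' i \<and> g' (Suc i) = f' i - 1)"
    if "tri f' = tri g'" "slice f'" "slice g'" for f' g'
  proof
    assume *: "f' (Suc i) = f' i \<and> g' (Suc i) = f' i - 1"
    then have a: "f' (Suc i) = f' i" and b: "g' (Suc i) = f' i - 1" by simp_all
    have "chord (Suc i) (g' (Suc i)) \<in> tri f'" "chord (Suc i) (f' (Suc i)) \<in> tri f'"
      unfolding that(1) using that(1) step.prems unfolding tri_def by auto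
    moreover have "crossing (chord (Suc i) (g' (Suc i))) (chord (Suc i) (f' (Suc i)))"
      using crossing_arc[of 1 "int i + 2" "int i + 3" "f' i - 1"] step.prems n6
      unfolding chord_def a b by (simp add: algebra_simps)
    ultimately show False using tri_noncrossing[OF that(2)] unfolding noncrossing_def by blast
  qed
  have "g i = f i" using step by simp
  moreover have "f (Suc i) = f i \<or> f (Suc i) = f i - 1" "g (Suc i) = g i \<or> g (Suc i) = g i - 1"
    using f g step unfolding slice_def by auto
  ultimately show ?case using no[OF eq f g] no[OF eq[symmetric] g f] by auto
qed (use one in simp)

text \<open>The ear chord \<open>chord 1 (f 1)\<close> can occur in \<open>g\<close> only in column
  1 or, read backwards, in column \<open>n - 3\<close>. A translate of \<open>f\<close>,
  respectively the reversal \<open>g'\<close> of \<open>g\<close>, then agrees in column 1 and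
  \<open>slice_determined\<close> applies.\<close>

lemma tri_eq_imp:
  assumes f: "slice f" and g: "slice g" and eq: "tri f = tri g"
  shows "(\<exists>k. \<forall>i. 1 \<le> i \<and> i \<le> n - 3 \<longrightarrow> g i = f i + k * int n) \<or>
    (\<exists>k. \<forall>i. 1 \<le> i \<and> i \<le> n - 3 \<longrightarrow> g (n - 2 - i) = f i + int i + 1 + k * int n)"
proof -
  have "chord 1 (f 1) \<in> tri g" unfolding eq[symmetric] unfolding tri_def
    using n6 by (intro CollectI exI[of _ 1]) simp
  then obtain j where j: "1 \<le> j" "j \<le> n - 3" "chord 1 (f 1) = chord j (g j)" unfolding tri_def by auto
  then consider "j = 1" "int n dvd g 1 - f 1" | "j = n - 3" "int n dvd g (n - 3) - (f 1 + 2)"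
    using chord_eq_iff[of 1 j "f 1" "g j"] n6 by (auto simp: add.assoc)
  then show ?thesis
  proof cases
    case 1
    then obtain k where "g 1 - f 1 = int n * k" by (elim dvdE)
    then have k: "g 1 = f 1 + k * int n" by (simp add: algebra_simps)
    have "slice (\<lambda>i. f i + k * int n)" "tri (\<lambda>i. f i + k * int n) = tri f"
      using f unfolding slice_def tri_def chord_shift by auto
    then have "g i = f i + k * int n" if "1 \<le> i" "i \<le> n - 3" for i
      using slice_determined[of "\<lambda>i. f i + k * int n" g i] g eq k that by simp
    then show ?thesis by blast
  next
    case 2
    then obtain k where "g (n - 3) - (f 1 + 2) = int n * k" by (elim dvdE)
    then have k: "g (n - 3) = f 1 + 2 + k * int n" by (simp add: algebra_simps)
    define g' where "g' i = g (n - 2 - i) - int i - 1 - k * int n" for i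
    have c: "chord i (g' i) = chord (n - 2 - i) (g (n - 2 - i))" if "i \<le> n - 2" for i
      using chord_reverse[OF that, of "g' i"] chord_shift[of "n - 2 - i" "g' i + int i + 1" k]
      unfolding g'_def by (simp add: algebra_simps)
    have "tri g' = tri g"
    proof (intro set_eqI iffI)
      fix e assume "e \<in> tri g'"
      then obtain i where "1 \<le> i" "i \<le> n - 3" "e = chord i (g' i)" unfolding tri_def by blast
      then show "e \<in> tri g" using c[of i] unfolding tri_def by (auto intro!: exI[of _ "n - 2 - i"])
    next
      fix e assume "e \<in> tri g"
      then obtain i where "1 \<le> i" "i \<le> n - 3" "e = chord i (g i)" unfolding tri_def by blast
      moreover have "n - 2 - (n - 2 - i) = i" using calculation n6 by simp
      ultimately show "e \<in> tri g'"
        using c[of "n - 2 - i"] n6 unfolding tri_def by (intro CollectI exI[of _ "n - 2 - i"]) auto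
    qed
    moreover have "slice g'"
    proof -
      have "g' (Suc i) = g' i \<or> g' (Suc i) = g' i - 1" if "1 \<le> i" "i < n - 3" for i
      proof -
        define j where "j = n - 3 - i"
        have "1 \<le> j" "j < n - 3" "n - 2 - i = Suc j" "n - 2 - Suc i = j"
          using that unfolding j_def by auto
        then show ?thesis using g[unfolded slice_def, rule_format, of j] unfolding g'_def by auto
      qed
      then show ?thesis unfolding slice_def by blast
    qed
    moreover have "g' 1 = f 1"
      using k n6 by (simp add: g'_def diff_diff_eq)
    ultimately have "g' i = f i" if "1 \<le> i" "i \<le> n - 3" for i
      using slice_determined[OF f, of g'] eq that by simp
    then show ?thesis unfolding g'_def by (intro disjI2 exI[of _ k]) (force simp: algebra_simps)
  qed
qed

text \<open>Translating a lift by \<open>n\<close> changes \<open>2 * x + i + 1\<close> by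
  \<open>2 * n\<close>, and reversal raises it by \<open>n\<close>. The lifts of one diagonal thus
  realize each value of one residue class modulo \<open>n\<close> once.\<close>

lemma unique_chord:
  assumes "e \<in> diagonals n"
  shows "\<exists>!p. 1 \<le> fst p \<and> fst p \<le> n - 3 \<and> chord (fst p) (snd p) = e \<and>
    c \<le> 2 * snd p + int (fst p) + 1 \<and> 2 * snd p + int (fst p) + 1 < c + int n"
proof (rule ex_ex1I)
  obtain u v where uv: "e = {u, v}" "u < v" "v < n" "{u, v} \<notin> sides n"
    
  proof -
    obtain u v where "e = {u, v}" "u < n" "v < n" "u \<noteq> v" "e \<notin> sides n"
      using assms unfolding diagonals_def by blast
    then show ?thesis using that[of u v] that[of v u] by (cases "u < v") (auto simp: insert_commute)
  qed
  define i where "i = v - u - 1"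
  have ne: "v \<noteq> Suc u" "\<not> (u = 0 \<and> v = n - 1)" using uv side_iff[of u v] by auto
  have i: "1 \<le> i" "i \<le> n - 3" using ne uv unfolding i_def by auto
  have e: "e = chord i (int u)" using uv unfolding i_def chord_def by simp
  define k where "k = (2 * int u + int i + 1 - c) div int n"
  have k: "c + k * int n \<le> 2 * int u + int i + 1" "2 * int u + int i + 1 < c + k * int n + int n"
    using div_mult_mod_eq[of "2 * int u + int i + 1 - c" "int n"] n6
      pos_mod_bound[of "int n" "2 * int u + int i + 1 - c"] pos_mod_sign[of "int n" "2 * int u + int i + 1 - c"]
    unfolding k_def by linarith+
  show "\<exists>p. 1 \<le> fst p \<and> fst p \<le> n - 3 \<and> chord (fst p) (snd p) = e \<and>
    c \<le> 2 * snd p + int (fst p) + 1 \<and> 2 * snd p + int (fst p) + 1 < c + int n"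
  \<comment> \<open>Lowering the height by \<open>k\<close> periods is a pure translation for even
    \<open>k\<close> and needs one reversal for odd \<open>k\<close>.\<close>
  proof (cases "even k")
    case True
    then obtain l where l: "k = 2 * l" by blast
    show ?thesis using k i e l chord_shift[of i "int u" "- l"]
      by (intro exI[of _ "(i, int u - l * int n)"]) (simp add: algebra_simps)
  next
    case False
    then obtain l where l: "k = 2 * l + 1" by (elim oddE)
    show ?thesis using k i e l chord_reverse[of i "int u"]
        chord_shift[of "n - 2 - i" "int u + int i + 1" "- l - 1"]
      by (intro exI[of _ "(n - 2 - i, int u + int i + 1 - (l + 1) * int n)"]) (auto simp: algebra_simps of_nat_diff)
  qed
next
  fix p q :: "nat \<times> int"
  obtain i x j y where pq: "p = (i, x)" "q = (j, y)" by (metis surj_pair)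
  assume p: "1 \<le> fst p \<and> fst p \<le> n - 3 \<and> chord (fst p) (snd p) = e \<and>
    c \<le> 2 * snd p + int (fst p) + 1 \<and> 2 * snd p + int (fst p) + 1 < c + int n"
    and q: "1 \<le> fst q \<and> fst q \<le> n - 3 \<and> chord (fst q) (snd q) = e \<and>
    c \<le> 2 * snd q + int (fst q) + 1 \<and> 2 * snd q + int (fst q) + 1 < c + int n"
  have "i = j \<and> int n dvd y - x \<or> j = n - 2 - i \<and> int n dvd y - (x + int i + 1)"
    using p q pq chord_eq_iff[of i j x y] by simp
  then show "p = q"
  proof
    assume *: "i = j \<and> int n dvd y - x"
    have "\<bar>y - x\<bar> < int n" using p q pq * by auto
    then show ?thesis using dvd_small[of "y - x"] * pq by auto
  next
    assume *: "j = n - 2 - i \<and> int n dvd y - (x + int i + 1)"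
    then have j: "int j = int n - 2 - int i" using p pq n6 by auto
    define z where "z = y - (x + int i + 1)"
    have y: "y = x + int i + 1 + z" unfolding z_def by simp
    have "2 * z + int n < int n" "- int n < 2 * z + int n"
      using p q unfolding pq y by (simp_all add: j)
    then have "z < 0" "- int n < z" by simp_all
    then show ?thesis using dvd_small[of z] * unfolding z_def by auto
  qed
qed

end

section \<open>Walks of slices\<close>

context ngon
begin

definition apply_move :: "(nat \<Rightarrow> int) \<Rightarrow> nat \<times> int \<Rightarrow> nat \<Rightarrow> int" where
  "apply_move f m = f(fst m := f (fst m) + snd m)"

fun states :: "(nat \<Rightarrow> int) \<Rightarrow> (nat \<times> int) list \<Rightarrow> (nat \<Rightarrow> int) list" where
  "states f [] = []"
| "states f (m # ms) = f # states (apply_move f m) ms"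

fun removed :: "(nat \<Rightarrow> int) \<Rightarrow> (nat \<times> int) list \<Rightarrow> nat set list" where
  "removed f [] = []"
| "removed f (m # ms) = chord (fst m) (f (fst m)) # removed (apply_move f m) ms"

fun walk :: "(nat \<Rightarrow> int) \<Rightarrow> (nat \<times> int) list \<Rightarrow> bool" where
  "walk f [] \<longleftrightarrow> slice f"
| "walk f (m # ms) \<longleftrightarrow> slice f \<and> 1 \<le> fst m \<and> fst m \<le> n - 3 \<and> \<bar>snd m\<bar> = 1 \<and> walk (apply_move f m) ms"

abbreviation final :: "(nat \<Rightarrow> int) \<Rightarrow> (nat \<times> int) list \<Rightarrow> nat \<Rightarrow> int" where
  "final f ms \<equiv> foldl apply_move f ms"

lemma states_append: "states f (ms @ ms') = states f ms @ states (final f ms) ms'"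
  by (induction ms arbitrary: f) simp_all

lemma removed_append: "removed f (ms @ ms') = removed f ms @ removed (final f ms) ms'"
  by (induction ms arbitrary: f) simp_all

lemma walk_slice: "walk f ms \<Longrightarrow> slice f"
  by (cases ms) simp_all

lemma walk_append: "walk f (ms @ ms') \<longleftrightarrow> walk f ms \<and> walk (final f ms) ms'"
  by (induction ms arbitrary: f) (auto dest: walk_slice)

lemma length_states [simp]: "length (states f ms) = length ms"
  by (induction ms arbitrary: f) simp_all

lemma length_removed [simp]: "length (removed f ms) = length ms"
  by (induction ms arbitrary: f) simp_all

lemma states_nth: "i < length ms \<Longrightarrow> states f ms ! i = final f (take i ms)"
  by (induction ms arbitrary: f i) (auto simp: nth_Cons split: nat.splits)

lemma removed_nth:
  "i < length ms \<Longrightarrow> removed f ms ! i = chord (fst (ms ! i)) (final f (take i ms) (fst (ms ! i)))"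
  by (induction ms arbitrary: f i) (auto simp: nth_Cons split: nat.splits)

lemma walk_nth:
  assumes "walk f ms" "i < length ms"
  shows "walk (final f (take i ms)) (drop i ms)"
  using assms walk_append[of f "take i ms" "drop i ms"] by simp

lemma walk_states: "walk f ms \<Longrightarrow> g \<in> set (states f ms) \<Longrightarrow> slice g"
  by (induction ms arbitrary: f) auto

lemma chord_in_tri: "1 \<le> i \<Longrightarrow> i \<le> n - 3 \<Longrightarrow> chord i (f i) \<in> tri f"
  unfolding tri_def by blast

text \<open>A downward move is an upward move read backwards, so \<open>tri_flip_up\<close> serves
  both directions; \<open>flip_unique\<close> makes the removed chord the only possible
  colour.\<close>

lemma walk_step:
  assumes "walk f (m # ms)"
  shows "flip n (tri f) e (tri (apply_move f m)) \<longleftrightarrow> e = chord (fst m) (f (fst m))"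
proof -
  obtain i d where m: "m = (i, d)" by (metis surj_pair)
  define h where "h = apply_move f m"
  have i: "1 \<le> i" "i \<le> n - 3" "d = 1 \<or> d = - 1" and f: "slice f" and h: "slice h"
    using assms walk_slice unfolding m h_def by auto
  have "flip n (tri f) (chord i (f i)) (tri h) \<and> (\<exists>b. tri h = insert b (tri f - {chord i (f i)}) \<and> b \<notin> tri f)"
    using i(3)
  proof
    assume "d = 1"
    then have a: "h = f(i := f i + 1)" unfolding h_def apply_move_def m by simp
    show ?thesis using tri_flip_up[OF f h[unfolded a] i(1,2)] unfolding a by blast
  next
    assume "d = - 1"
    then have a: "f = h(i := h i + 1)" "f i = h i + 1" unfolding h_def apply_move_def m by auto
    have sf: "slice (h(i := h i + 1))" using f unfolding a(1)[symmetric] .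
    note fl = tri_flip_up[OF h sf i(1,2), folded a]
    have swap: "B = insert b (A - {a}) \<and> b \<notin> A" if "A = insert a (B - {b})" "a \<notin> B" "b \<in> B"
      for A B :: "nat set set" and a b using that by auto
    show ?thesis using swap[OF fl(3,4) chord_in_tri[OF i(1,2)]] fl(2) by blast
  qed
  then obtain b where fl: "flip n (tri f) (chord i (f i)) (tri h)"
      "tri h = insert b (tri f - {chord i (f i)})" "b \<notin> tri f" by (elim conjE exE)
  have "e = chord i (f i)" if "flip n (tri f) e (tri h)"
    using flip_unique[OF that fl(2) chord_in_tri[OF i(1,2)] fl(3)] .
  then have "flip n (tri f) e (tri h) \<longleftrightarrow> e = chord i (f i)" using fl(1) by (intro iffI) simp_all
  then show ?thesis unfolding h_def by (simp add: m)
qed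

lemma rainbow_cycle_walk:
  assumes w: "walk f ms" and l: "3 \<le> length ms" and c: "tri (final f ms) = tri f"
    and d: "distinct (map tri (states f ms))"
    and r: "\<And>e. e \<in> diagonals n \<Longrightarrow> count_list (removed f ms) e = r"
  shows "rainbow_cycle n r (map tri (states f ms))"
proof -
  let ?Ts = "map tri (states f ms)" and ?L = "length ms"
  have next': "?Ts ! (Suc i mod ?L) = tri (final f (take (Suc i) ms))" if "i < ?L" for i
  proof (cases "Suc i < ?L")
    case False
    then have [simp]: "Suc i = ?L" using that by simp
    moreover have "0 < ?L" using \<open>3 \<le> ?L\<close> by linarith
    ultimately show ?thesis using c by (simp add: states_nth)
  qed (simp add: states_nth)
  have fl: "flip n (?Ts ! i) e (?Ts ! (Suc i mod ?L)) \<longleftrightarrow> e = removed f ms ! i" if "i < ?L" for i e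
  proof -
    have "drop i ms = ms ! i # drop (Suc i) ms" using that by (simp add: Cons_nth_drop_Suc)
    then have "walk (final f (take i ms)) (ms ! i # drop (Suc i) ms)" using walk_nth[OF w that] by metis
    note step = walk_step[OF this, of e]
    have "apply_move (final f (take i ms)) (ms ! i) = final f (take (Suc i) ms)"
      using that by (simp add: take_Suc_conv_app_nth)
    then show ?thesis
      unfolding next'[OF that] using step that by (simp add: states_nth removed_nth)
  qed
  have "set ?Ts \<subseteq> assoc_vertices n"
    unfolding assoc_vertices_def using tri_triangulation walk_states[OF w] by auto
  moreover have "\<exists>e. flip n (?Ts ! i) e (?Ts ! (Suc i mod ?L))" if "i < ?L" for i
    using fl[OF that] by metis
  ultimately have "assoc_cycle n ?Ts"
    unfolding assoc_cycle_def assoc_adj_def using l d by simp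
  moreover have "card {i. i < length ?Ts \<and> flip n (?Ts ! i) e (?Ts ! (Suc i mod length ?Ts))} = r"
    if "e \<in> diagonals n" for e
  proof -
    have "{i. i < length ?Ts \<and> flip n (?Ts ! i) e (?Ts ! (Suc i mod length ?Ts))}
      = {i. i < length (removed f ms) \<and> e = removed f ms ! i}" using fl by auto
    then show ?thesis using r[OF that] by (simp add: count_list_eq_length_filter length_filter_conv_card)
  qed
  ultimately show ?thesis unfolding rainbow_cycle_def by blast
qed

text \<open>
  The lifted sum of the two endpoints of \<open>chord i (f i)\<close>. The same chord is also
  \<open>chord (n - 2 - i) (f i + i + 1)\<close>, which raises this sum by \<open>n\<close>.
\<close>

definition height :: "(nat \<Rightarrow> int) \<Rightarrow> nat \<Rightarrow> int" where
  "height f i = 2 * f i + int i + 1"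

text \<open>The parity of the multiple of \<open>n\<close> is what later excludes reversals: an odd
  multiple is never 0.\<close>

lemma tri_eq_height:
  assumes "slice f" "slice g" "tri f = tri g"
  shows "(\<exists>k. \<forall>i. 1 \<le> i \<and> i \<le> n - 3 \<longrightarrow> height g i = height f i + 2 * k * int n) \<or>
    (\<exists>k. \<forall>i. 1 \<le> i \<and> i \<le> n - 3 \<longrightarrow> height g (n - 2 - i) = height f i + (2 * k + 1) * int n)"
  using tri_eq_imp[OF assms]
proof
  assume "\<exists>k. \<forall>i. 1 \<le> i \<and> i \<le> n - 3 \<longrightarrow> g i = f i + k * int n"
  then obtain k where "\<And>i. 1 \<le> i \<Longrightarrow> i \<le> n - 3 \<Longrightarrow> g i = f i + k * int n" by blast
  then show ?thesis unfolding height_def by (intro disjI1 exI[of _ k]) (simp add: algebra_simps)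
next
  assume "\<exists>k. \<forall>i. 1 \<le> i \<and> i \<le> n - 3 \<longrightarrow> g (n - 2 - i) = f i + int i + 1 + k * int n"
  then obtain k where k: "\<And>i. 1 \<le> i \<Longrightarrow> i \<le> n - 3 \<Longrightarrow> g (n - 2 - i) = f i + int i + 1 + k * int n" by blast
  have "int (n - 2 - i) = int n - 2 - int i" if "i \<le> n - 3" for i using that n6 by auto
  then show ?thesis unfolding height_def using k
    by (intro disjI2 exI[of _ k]) (simp add: algebra_simps)
qed

definition node_count :: "(nat \<times> int) set \<Rightarrow> nat set \<Rightarrow> nat" where
  "node_count P e = card {p \<in> P. chord (fst p) (snd p) = e}"

text \<open>A fundamental domain for the lifts \<open>(i, x)\<close> of diagonals: one period of
  heights.\<close>

definition window :: "int \<Rightarrow> (nat \<times> int) set" where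
  "window c = {p. 1 \<le> fst p \<and> fst p \<le> n - 3 \<and>
    c \<le> 2 * snd p + int (fst p) + 1 \<and> 2 * snd p + int (fst p) + 1 < c + int n}"

lemma node_count_window: "e \<in> diagonals n \<Longrightarrow> node_count (window c) e = 1"
proof -
  assume "e \<in> diagonals n"
  from unique_chord[OF this, of c] obtain p where
    "\<And>q. q \<in> window c \<and> chord (fst q) (snd q) = e \<longleftrightarrow> q = p"
    unfolding window_def mem_Collect_eq by (elim ex1E) (metis (no_types, lifting))
  then have "{q \<in> window c. chord (fst q) (snd q) = e} = {p}" by auto
  then show ?thesis unfolding node_count_def by simp
qed

end

section \<open>The tour through the zigzag cubes\<close>

context ngon
begin

lemma length_ge_3:
  assumes "0 < r" "\<And>e. e \<in> diagonals n \<Longrightarrow> count_list xs e = r"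
  shows "3 \<le> length xs"
proof -
  let ?D = "{chord 1 0, chord 1 1, chord 1 2}"
  have "e \<in> set xs" if "e \<in> diagonals n" for e
    using assms(1) assms(2)[OF that] count_notin[of e xs] by auto
  then have "?D \<subseteq> set xs" using chord_in_diagonals[of 1] n6 by simp
  moreover have "chord 1 x \<noteq> chord 1 y" if "x < y" "y < x + 3" for x y
  proof
    assume "chord 1 x = chord 1 y"
    moreover have "1 \<le> n - 3" "1 \<noteq> n - 2 - 1" using n6 by linarith+
    ultimately have "int n dvd y - x" using chord_eq_iff[of 1 1 x y] by blast
    then show False using dvd_small[of "y - x"] that n6 by simp
  qed
  then have "card ?D = 3" by simp
  ultimately have "3 \<le> card (set xs)" using card_mono[of "set xs" ?D] by simp
  then show ?thesis using card_length[of xs] by linarith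
qed

text \<open>
  \<open>cube t {}\<close> is a zigzag triangulation; its flippable columns \<open>cols t\<close> are independent of each
  other, and flipping all of them yields the zigzag \<open>cube (t + 1) {}\<close>.
\<close>

definition cols :: "int \<Rightarrow> nat set" where
  "cols t = {i. 1 \<le> i \<and> i \<le> n - 3 \<and> odd (t - int i)}"

definition cube :: "int \<Rightarrow> nat set \<Rightarrow> nat \<Rightarrow> int" where
  "cube t S i = (if 1 \<le> i \<and> i \<le> n - 3 then (t - int i + of_bool (i \<in> S)) div 2 else 0)"

lemma finite_cols: "finite (cols t)"
  unfolding cols_def by (rule finite_subset[of _ "{..n - 3}"]) auto

lemma card_cols: "(n - 3) div 2 \<le> card (cols t)"
proof -
  define p where "p = (if even t then 1 else 2 :: nat)"
  have "(\<lambda>j. 2 * j + p) ` {..<(n - 3) div 2} \<subseteq> cols t"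
    unfolding cols_def p_def by auto
  moreover have "card ((\<lambda>j. 2 * j + p) ` {..<(n - 3) div 2}) = (n - 3) div 2"
    by (subst card_image) (auto simp: inj_on_def)
  ultimately show ?thesis by (metis card_mono finite_cols)
qed

lemma in_cols: "i \<in> cols t \<Longrightarrow> 1 \<le> i \<and> i \<le> n - 3 \<and> (\<exists>k. t - int i = 2 * k + 1)"
  unfolding cols_def mem_Collect_eq by (elim conjE oddE) blast

lemma notin_cols: "1 \<le> i \<Longrightarrow> i \<le> n - 3 \<Longrightarrow> i \<notin> cols t \<Longrightarrow> \<exists>k. t - int i = 2 * k"
  unfolding cols_def mem_Collect_eq by (metis evenE)

lemma cube_cases:
  assumes "S \<subseteq> cols t" "1 \<le> i" "i \<le> n - 3"
  shows "2 * cube t S i = (if i \<in> cols t then t - int i - 1 + 2 * of_bool (i \<in> S) else t - int i)"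
proof (cases "i \<in> cols t")
  case True
  then obtain k where k: "t - int i = 2 * k + 1" using in_cols by blast
  show ?thesis unfolding cube_def k using True assms by simp
next
  case False
  then obtain k where k: "t - int i = 2 * k" using notin_cols assms by blast
  show ?thesis unfolding cube_def k using False assms by auto
qed

lemma slice_cube:
  assumes "S \<subseteq> cols t"
  shows "slice (cube t S)"
  unfolding slice_def
proof (intro allI impI)
  fix i assume i: "1 \<le> i \<and> i < n - 3"
  have "i \<in> cols t \<longleftrightarrow> Suc i \<notin> cols t" using i unfolding cols_def by auto
  moreover have "i \<in> S \<Longrightarrow> i \<in> cols t" "Suc i \<in> S \<Longrightarrow> Suc i \<in> cols t" using assms by auto
  ultimately show "cube t S (Suc i) = cube t S i \<or> cube t S (Suc i) = cube t S i - 1"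
    using cube_cases[OF assms, of i] cube_cases[OF assms, of "Suc i"] i
    by (cases "i \<in> cols t"; cases "i \<in> S"; cases "Suc i \<in> S") auto
qed

text \<open>The heights lie in \<open>t, t + 1, t + 2\<close>, and the minimum \<open>t\<close> is
  attained exactly when \<open>S\<close> is not full; so \<open>t\<close> can be recovered from the
  slice.\<close>

lemma height_cube:
  assumes "S \<subseteq> cols t" "1 \<le> i" "i \<le> n - 3"
  shows "height (cube t S) i = (if i \<in> cols t then t + 2 * of_bool (i \<in> S) else t + 1)"
  using cube_cases[OF assms] unfolding height_def by auto

lemma cube_full: "cube t (cols t) = cube (t + 1) {}"
proof
  fix i
  show "cube t (cols t) i = cube (t + 1) {} i"
    using cube_cases[of "cols t" t i] cube_cases[of "{}" "t + 1" i]
    by (cases "1 \<le> i \<and> i \<le> n - 3") (auto simp: cols_def cube_def)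
qed

lemma apply_move_cube:
  assumes "i \<in> cols t"
  shows "apply_move (cube t S) (i, if i \<in> S then - 1 else 1) = cube t (toggle i S)"
proof
  fix j
  show "apply_move (cube t S) (i, if i \<in> S then - 1 else 1) j = cube t (toggle i S) j"
    using assms unfolding apply_move_def cube_def toggle_def cols_def by (auto elim!: oddE)
qed

fun cube_moves :: "nat set \<Rightarrow> nat list \<Rightarrow> (nat \<times> int) list" where
  "cube_moves S [] = []"
| "cube_moves S (i # w) = (i, if i \<in> S then - 1 else 1) # cube_moves (toggle i S) w"

lemma length_cube_moves [simp]: "length (cube_moves S w) = length w"
  by (induction w arbitrary: S) simp_all

lemma states_cube:
  assumes "set w \<subseteq> cols t"
  shows "states (cube t S) (cube_moves S w) = map (cube t) (trace S w)"
  using assms by (induction w arbitrary: S) (simp_all add: apply_move_cube)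

lemma final_cube:
  assumes "set w \<subseteq> cols t"
  shows "final (cube t S) (cube_moves S w) = cube t (fold toggle w S)"
  using assms by (induction w arbitrary: S) (simp_all add: apply_move_cube)

lemma walk_cube:
  assumes "S \<subseteq> cols t" "set w \<subseteq> cols t"
  shows "walk (cube t S) (cube_moves S w)"
  using assms
proof (induction w arbitrary: S)
  case (Cons i w)
  then have "1 \<le> i" "i \<le> n - 3" unfolding cols_def by auto
  then show ?case using Cons toggle_subset[of S "cols t" i]
    by (simp add: apply_move_cube slice_cube)
qed (simp add: slice_cube)

text \<open>The toggles of a column alternate between its two values. Of \<open>c\<close> toggles,
  half rounded up leave the value at which the column starts and half rounded down leave the other;
  the \<open>of_bool\<close> terms do the rounding.\<close>

lemma removed_cube:
  assumes "set w \<subseteq> cols t"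
  shows "count_list (removed (cube t S) (cube_moves S w)) e =
    (\<Sum>i\<in>cols t. (if chord i ((t - int i) div 2) = e then (count_list w i + of_bool (i \<notin> S)) div 2 else 0)
      + (if chord i ((t - int i) div 2 + 1) = e then (count_list w i + of_bool (i \<in> S)) div 2 else 0))"
  using assms
proof (induction w arbitrary: S)
  case Nil
  have "of_bool b div 2 = (0 :: nat)" for b by (cases b) auto
  then show ?case by (simp cong: if_cong)
next
  case (Cons j w)
  define F where "F S w i = (if chord i ((t - int i) div 2) = e then (count_list w i + of_bool (i \<notin> S)) div 2 else 0)
      + (if chord i ((t - int i) div 2 + 1) = e then (count_list w i + of_bool (i \<in> S)) div 2 else 0)"
    for S :: "nat set" and w :: "nat list" and i
  have j: "j \<in> cols t" using Cons by simp
  have IH: "count_list (removed (cube t (toggle j S)) (cube_moves (toggle j S) w)) e = (\<Sum>i\<in>cols t. F (toggle j S) w i)"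
    using Cons unfolding F_def by simp
  obtain k where "t - int j = 2 * k + 1" using in_cols[OF j] by blast
  then have "(t - int j + 1) div 2 = (t - int j) div 2 + 1" by simp
  then have cj: "cube t S j = (t - int j) div 2 + of_bool (j \<in> S)"
    using j unfolding cube_def cols_def by auto
  have "count_list (removed (cube t S) (cube_moves S (j # w))) e =
    (if chord j ((t - int j) div 2 + of_bool (j \<in> S)) = e then 1 else 0) + (\<Sum>i\<in>cols t. F (toggle j S) w i)"
    using IH j by (simp add: apply_move_cube cj)
  also have "(\<Sum>i\<in>cols t. F (toggle j S) w i) = F (toggle j S) w j + (\<Sum>i\<in>cols t - {j}. F (toggle j S) w i)"
    by (rule sum.remove[OF finite_cols j])
  also have "(\<Sum>i\<in>cols t - {j}. F (toggle j S) w i) = (\<Sum>i\<in>cols t - {j}. F S (j # w) i)"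
    by (rule sum.cong) (auto simp: F_def toggle_def)
  also have "(if chord j ((t - int j) div 2 + of_bool (j \<in> S)) = e then 1 else 0) +
    (F (toggle j S) w j + (\<Sum>i\<in>cols t - {j}. F S (j # w) i)) = F S (j # w) j + (\<Sum>i\<in>cols t - {j}. F S (j # w) i)"
    by (cases "j \<in> S") (auto simp: F_def toggle_def)
  also have "\<dots> = (\<Sum>i\<in>cols t. F S (j # w) i)"
    by (rule sum.remove[OF finite_cols j, symmetric])
  finally show ?case unfolding F_def .
qed

text \<open>Both minimal heights, \<open>t\<close> and \<open>t'\<close>, are attained because
  \<open>S\<close> and \<open>S'\<close> are proper subsets. So the multiple of \<open>n\<close>
  relating the heights equals \<open>t' - t\<close>, which is too small unless it is 0.\<close>

lemma tri_cube_eq: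
  assumes S: "S \<subset> cols t" and S': "S' \<subset> cols t'" and t: "\<bar>t - t'\<bar> < int n"
    and eq: "tri (cube t S) = tri (cube t' S')"
  shows "t = t' \<and> S = S'"
proof -
  let ?f = "cube t S" and ?g = "cube t' S'"
  note hf = height_cube[OF psubset_imp_subset[OF S]] and hg = height_cube[OF psubset_imp_subset[OF S']]
  obtain i0 j0 where i0: "i0 \<in> cols t" "i0 \<notin> S" and j0: "j0 \<in> cols t'" "j0 \<notin> S'" using S S' by blast
  have r: "1 \<le> i0" "i0 \<le> n - 3" "1 \<le> j0" "j0 \<le> n - 3" using i0 j0 unfolding cols_def by auto
  have lf: "t \<le> height ?f i" if "1 \<le> i" "i \<le> n - 3" for i using hf[OF that] by simp
  have lg: "t' \<le> height ?g i" if "1 \<le> i" "i \<le> n - 3" for i using hg[OF that] by simp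
  have m: "height ?f i0 = t" "height ?g j0 = t'" using hf hg r i0 j0 by simp_all
  have shift: "K = 0 \<and> t = t'" if "t' \<le> t + K * int n" "t + K * int n \<le> t'" for K
  proof -
    have e: "t' - t = K * int n" using that by simp
    then have "t' - t = 0" using dvd_small[of "t' - t"] t by (simp add: abs_minus_commute)
    then show ?thesis using e n6 by simp
  qed
  have slices: "slice ?f" "slice ?g" using slice_cube S S' by blast+
  from tri_eq_height[OF slices eq] show ?thesis
  proof
    assume "\<exists>k. \<forall>i. 1 \<le> i \<and> i \<le> n - 3 \<longrightarrow> height ?g i = height ?f i + 2 * k * int n"
    then obtain k where k: "\<And>i. 1 \<le> i \<Longrightarrow> i \<le> n - 3 \<Longrightarrow> height ?g i = height ?f i + (2 * k) * int n" by blast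
    have *: "2 * k = 0 \<and> t = t'"
      using k[of i0] k[of j0] lg[of i0] lf[of j0] m r by (intro shift) auto
    then have "i \<in> S \<longleftrightarrow> i \<in> S'" if "i \<in> cols t" for i
      using k[of i] hf[of i] hg[of i] that unfolding cols_def by (auto split: if_splits)
    then show ?thesis using * S S' by blast
  next
    assume "\<exists>k. \<forall>i. 1 \<le> i \<and> i \<le> n - 3 \<longrightarrow> height ?g (n - 2 - i) = height ?f i + (2 * k + 1) * int n"
    then obtain k where k: "\<And>i. 1 \<le> i \<Longrightarrow> i \<le> n - 3 \<Longrightarrow>
      height ?g (n - 2 - i) = height ?f i + (2 * k + 1) * int n" by blast
    have "n - 2 - (n - 2 - j0) = j0" "1 \<le> n - 2 - j0" "n - 2 - j0 \<le> n - 3" "1 \<le> n - 2 - i0" "n - 2 - i0 \<le> n - 3"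
      using r n6 by auto
    then have "2 * k + 1 = 0"
      using k[of i0] k[of "n - 2 - j0"] lg[of "n - 2 - i0"] lf[of "n - 2 - j0"] m r shift[of "2 * k + 1"] by auto
    then show ?thesis by presburger
  qed
qed

text \<open>After \<open>n\<close> cubes the tour closes up by the reversal of all chords, which
  raises the heights by \<open>n\<close>, not by a translation.\<close>

lemma tri_cube_period: "tri (cube (t + int n) {}) = tri (cube t {})"
proof -
  have *: "chord (n - 2 - i) (cube (t + int n) {} (n - 2 - i)) = chord i (cube t {} i)"
    if "1 \<le> i" "i \<le> n - 3" for i
  proof -
    have "t + int n - int (n - 2 - i) = t - int i + 2 * (int i + 1)" using that n6 by auto
    then have "(t + int n - int (n - 2 - i)) div 2 = (t - int i) div 2 + int i + 1" by simp
    then have "cube (t + int n) {} (n - 2 - i) = cube t {} i + int i + 1" using that n6 unfolding cube_def by auto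
    then show ?thesis using chord_reverse[of i "cube t {} i"] that by simp
  qed
  show ?thesis
  proof (intro set_eqI iffI)
    fix e assume "e \<in> tri (cube t {})"
    then obtain i where "1 \<le> i" "i \<le> n - 3" "e = chord i (cube t {} i)" unfolding tri_def by blast
    then show "e \<in> tri (cube (t + int n) {})"
      using *[of i] n6 unfolding tri_def by (intro CollectI exI[of _ "n - 2 - i"]) auto
  next
    fix e assume "e \<in> tri (cube (t + int n) {})"
    then obtain i where i: "1 \<le> i" "i \<le> n - 3" "e = chord i (cube (t + int n) {} i)" unfolding tri_def by blast
    moreover have "n - 2 - (n - 2 - i) = i" using i n6 by simp
    ultimately show "e \<in> tri (cube t {})"
      using *[of "n - 2 - i"] n6 unfolding tri_def by (intro CollectI exI[of _ "n - 2 - i"]) auto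
  qed
qed

text \<open>For \<open>i\<close> in \<open>cols t\<close> the lift has height
  \<open>t + 2 * d\<close>, so letting \<open>t\<close> run through \<open>n\<close> values fills
  one window. The lower values of the columns are \<open>d = 0\<close>, the upper ones
  \<open>d = 1\<close>.\<close>

lemma sum_node_count:
  "(\<Sum>t<n. \<Sum>i\<in>cols (int t). of_bool (chord i ((int t - int i) div 2 + d) = e)) = node_count (window (2 * d)) e"
proof -
  let ?A = "SIGMA t:{..<n}. {i \<in> cols (int t). chord i ((int t - int i) div 2 + d) = e}"
  have "(\<Sum>t<n. \<Sum>i\<in>cols (int t). of_bool (chord i ((int t - int i) div 2 + d) = e)) =
    (\<Sum>t<n. card {i \<in> cols (int t). chord i ((int t - int i) div 2 + d) = e})"
    using finite_cols by (simp add: Int_def)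
  also have "\<dots> = card ?A" using finite_cols by simp
  also have "\<dots> = node_count (window (2 * d)) e"
    unfolding node_count_def
  proof (rule bij_betw_same_card)
    let ?B = "{p \<in> window (2 * d). chord (fst p) (snd p) = e}"
    define F where "F p = (snd p, (int (fst p) - int (snd p)) div 2 + d)" for p :: "nat \<times> nat"
    define G where "G p = (nat (2 * (snd p - d) + int (fst p) + 1), fst p)" for p :: "nat \<times> int"
    have F: "F p \<in> ?B \<and> G (F p) = p" if A: "p \<in> ?A" for p
    proof -
      obtain t i where ti: "p = (t, i)" "i \<in> cols (int t)" "t < n" "chord i ((int t - int i) div 2 + d) = e"
        using A by auto
      then obtain k where k: "int t - int i = 2 * k + 1" using in_cols by blast
      then have t: "int t = 2 * k + 1 + int i" by simp
      have Fp: "F p = (i, k + d)" unfolding F_def ti(1) by (simp add: k)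
      have "(int t - int i) div 2 = k" using k by simp
      then have "chord i (k + d) = e" using ti(4) by simp
      moreover have "(i, k + d) \<in> window (2 * d)"
        using ti(3) in_cols[OF ti(2)] t unfolding window_def by simp
      moreover have "nat (2 * k + int i + 1) = t" using t by simp
      ultimately show ?thesis unfolding Fp by (simp add: G_def ti(1))
    qed
    have G: "G p \<in> ?A \<and> F (G p) = p" if "p \<in> ?B" for p
    proof -
      obtain i x where ix: "p = (i, x)" by (metis surj_pair)
      define h where "h = nat (2 * (x - d) + int i + 1)"
      have p: "0 \<le> 2 * (x - d) + int i + 1" "2 * (x - d) + int i + 1 < int n" "1 \<le> i" "i \<le> n - 3" "chord i x = e"
        using that ix unfolding window_def by auto
      then have h: "int h - int i = 2 * (x - d) + 1" "h < n" unfolding h_def by (auto simp: nat_less_iff)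
      have Gp: "G p = (h, i)" unfolding G_def h_def ix by simp
      have x: "(int h - int i) div 2 + d = x" unfolding h(1) by simp
      moreover have "odd (int h - int i)" unfolding h(1) by simp
      ultimately have "(h, i) \<in> ?A" using p h(2) unfolding cols_def by simp
      then show ?thesis unfolding Gp by (simp add: F_def x ix)
    qed
    show "bij_betw F ?A ?B"
      by (rule bij_betw_byWitness[where f' = G]) (use F G in blast)+
  qed
  finally show ?thesis .
qed

end

section \<open>Passing through \<open>n\<close> consecutive cubes\<close>

locale cube_tour = ngon +
  fixes s :: nat and w :: "nat \<Rightarrow> nat list"
  assumes w_set: "t < n \<Longrightarrow> set (w t) \<subseteq> cols (int t)"
    and w_count: "t < n \<Longrightarrow> i \<in> cols (int t) \<Longrightarrow> count_list (w t) i = 2 * s + 1"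
    and w_distinct: "t < n \<Longrightarrow> distinct (trace {} (w t))"
    and w_final: "t < n \<Longrightarrow> fold toggle (w t) {} = cols (int t)"
    and w_full: "t < n \<Longrightarrow> cols (int t) \<notin> set (trace {} (w t))"
begin

definition tour :: "nat \<Rightarrow> (nat \<times> int) list" where
  "tour k = concat (map (\<lambda>t. cube_moves {} (w t)) [0..<k])"

lemma tour_Suc: "tour (Suc k) = tour k @ cube_moves {} (w k)"
  unfolding tour_def by simp

lemma final_tour: "k \<le> n \<Longrightarrow> final (cube 0 {}) (tour k) = cube (int k) {}"
proof (induction k)
  case (Suc k)
  then show ?case
    using final_cube[OF w_set[of k], of "{}"] w_final[of k] cube_full[of "int k"]
    by (simp add: tour_Suc add.commute)
qed (simp add: tour_def)

lemma walk_tour: "k \<le> n \<Longrightarrow> walk (cube 0 {}) (tour k)"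
proof (induction k)
  case (Suc k)
  then show ?case
    using walk_cube[OF _ w_set[of k], of "{}"] by (simp add: tour_Suc walk_append final_tour)
qed (simp add: tour_def slice_cube)

lemma mem_states_tour:
  assumes "k \<le> n" "f \<in> set (states (cube 0 {}) (tour k))"
  shows "\<exists>t<k. \<exists>S\<in>set (trace {} (w t)). S \<subset> cols (int t) \<and> f = cube (int t) S"
  using assms
proof (induction k)
  case (Suc k)
  have sub: "S \<subset> cols (int k)" if "S \<in> set (trace {} (w k))" for S
    using trace_subset[OF _ w_set that, of ] w_full[of k] Suc.prems(1) that by force
  show ?case using Suc sub states_cube[OF w_set[of k], of "{}"]
    by (fastforce simp: tour_Suc states_append final_tour less_Suc_eq)
qed (simp add: tour_def)

lemma distinct_tour: "k \<le> n \<Longrightarrow> distinct (map tri (states (cube 0 {}) (tour k)))"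
proof (induction k)
  case (Suc k)
  have k: "k < n" using Suc by simp
  have sub: "S \<subset> cols (int k)" if "S \<in> set (trace {} (w k))" for S
    using trace_subset[OF _ w_set[OF k] that] w_full[OF k] that by force
  have "inj_on (\<lambda>S. tri (cube (int k) S)) (set (trace {} (w k)))"
    using tri_cube_eq[of _ "int k" _ "int k"] sub n6 by (intro inj_onI) auto
  then have d: "distinct (map (\<lambda>S. tri (cube (int k) S)) (trace {} (w k)))"
    using w_distinct[OF k] by (simp add: distinct_map)
  have "tri f \<noteq> tri (cube (int k) S)" if f: "f \<in> set (states (cube 0 {}) (tour k))" and S: "S \<in> set (trace {} (w k))" for f S
  proof -
    obtain t S' where "t < k" "S' \<subset> cols (int t)" "f = cube (int t) S'"
      using mem_states_tour[OF less_imp_le[OF k] f] by auto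
    then show ?thesis using tri_cube_eq[of S' "int t" S "int k"] sub[OF S] k by auto
  qed
  then show ?case using Suc d states_cube[OF w_set[OF k], of "{}"]
    by (auto simp: tour_Suc states_append final_tour comp_def)
qed (simp add: tour_def)

lemma removed_tour:
  assumes "e \<in> diagonals n"
  shows "count_list (removed (cube 0 {}) (tour n)) e = 2 * s + 1"
proof -
  let ?F = "\<lambda>t. \<Sum>i\<in>cols (int t). (s + 1) * of_bool (chord i ((int t - int i) div 2 + 0) = e)
      + s * of_bool (chord i ((int t - int i) div 2 + 1) = e)"
  have "count_list (removed (cube 0 {}) (tour k)) e = (\<Sum>t<k. ?F t)" if "k \<le> n" for k
    using that
  proof (induction k)
    case (Suc k)
    then have k: "k < n" by simp
    have "count_list (removed (cube (int k) {}) (cube_moves {} (w k))) e = ?F k"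
      unfolding removed_cube[OF w_set[OF k]]
      by (rule sum.cong) (simp_all add: w_count[OF k])
    then show ?case using Suc k by (simp add: tour_Suc removed_append final_tour)
  qed (simp add: tour_def)
  then have "count_list (removed (cube 0 {}) (tour n)) e = (\<Sum>t<n. ?F t)" by simp
  also have "\<dots> = (s + 1) * node_count (window (2 * 0)) e + s * node_count (window (2 * 1)) e"
    unfolding sum_node_count[symmetric] by (simp only: sum.distrib sum_distrib_left)
  finally show ?thesis using node_count_window[OF assms] by simp
qed

lemma odd_rainbow: "rainbow_cycle n (2 * s + 1) (map tri (states (cube 0 {}) (tour n)))"
proof (rule rainbow_cycle_walk)
  show "tri (final (cube 0 {}) (tour n)) = tri (cube 0 {})"
    using tri_cube_period[of 0] by (simp add: final_tour)
  show "3 \<le> length (tour n)"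
    using length_ge_3[OF _ removed_tour] by simp
qed (use walk_tour distinct_tour removed_tour in auto)

end

section \<open>Sweeping a fan between two slices\<close>

context ngon
begin

lemma slice_max:
  assumes "slice f" "slice g"
  shows "slice (\<lambda>i. max (f i) (g i))"
  unfolding slice_def
proof (intro allI impI)
  fix i assume "1 \<le> i \<and> i < n - 3"
  then have "f (Suc i) = f i \<or> f (Suc i) = f i - 1" "g (Suc i) = g i \<or> g (Suc i) = g i - 1"
    using assms unfolding slice_def by blast+
  then show "max (f (Suc i)) (g (Suc i)) = max (f i) (g i) \<or>
      max (f (Suc i)) (g (Suc i)) = max (f i) (g i) - 1"
    unfolding max_def by auto
qed

lemma slice_min:
  assumes "slice f" "slice g"
  shows "slice (\<lambda>i. min (f i) (g i))"
  unfolding slice_def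
proof (intro allI impI)
  fix i assume "1 \<le> i \<and> i < n - 3"
  then have "f (Suc i) = f i \<or> f (Suc i) = f i - 1" "g (Suc i) = g i \<or> g (Suc i) = g i - 1"
    using assms unfolding slice_def by blast+
  then show "min (f (Suc i)) (g (Suc i)) = min (f i) (g i) \<or>
      min (f (Suc i)) (g (Suc i)) = min (f i) (g i) - 1"
    unfolding min_def by auto
qed

lemma slice_cong: "slice f \<Longrightarrow> (\<And>i. 1 \<le> i \<Longrightarrow> i \<le> n - 3 \<Longrightarrow> g i = f i) \<Longrightarrow> slice g"
  unfolding slice_def by auto

text \<open>A potential that each upward move raises by one; it makes the slices of a monotone walk
  pairwise distinct.\<close>

definition weight :: "(nat \<Rightarrow> int) \<Rightarrow> int" where
  "weight f = (\<Sum>i = 1..n - 3. f i)"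

lemma weight_up: "1 \<le> i \<Longrightarrow> i \<le> n - 3 \<Longrightarrow> weight (apply_move f (i, 1)) = weight f + 1"
proof -
  assume i: "1 \<le> i" "i \<le> n - 3"
  have "weight (apply_move f (i, 1)) = (\<Sum>j = 1..n - 3. f j + (if j = i then 1 else 0))"
    unfolding weight_def apply_move_def by (rule sum.cong) auto
  then show ?thesis using i by (simp add: sum.distrib weight_def)
qed

lemma weight_states:
  assumes "\<And>m. m \<in> set ms \<Longrightarrow> 1 \<le> fst m \<and> fst m \<le> n - 3 \<and> snd m = 1"
  shows "(\<forall>g\<in>set (states f ms). weight f \<le> weight g \<and> weight g < weight (final f ms)) \<and>
    weight f \<le> weight (final f ms) \<and> distinct (map weight (states f ms))"
  using assms
proof (induction ms arbitrary: f)
  case (Cons m ms)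
  have m: "1 \<le> fst m" "fst m \<le> n - 3" "m = (fst m, 1)"
    using Cons.prems[of m] by (auto simp: prod_eq_iff)
  have up: "weight (apply_move f m) = weight f + 1" by (subst m(3)) (rule weight_up[OF m(1,2)])
  have IH: "\<And>g. g \<in> set (states (apply_move f m) ms) \<Longrightarrow> weight f < weight g \<and> weight g < weight (final (apply_move f m) ms)"
    "weight f < weight (final (apply_move f m) ms)" "distinct (map weight (states (apply_move f m) ms))"
    using Cons.IH[of "apply_move f m"] Cons.prems up by auto
  have "weight f \<notin> weight ` set (states (apply_move f m) ms)" using IH(1) by fastforce
  then show ?case using IH by (auto intro: less_imp_le)
qed simp

lemma finite_window: "finite (window c)"
proof (rule finite_subset)
  show "window c \<subseteq> {..n} \<times> {- \<bar>c\<bar> - int n..\<bar>c\<bar> + int n}" unfolding window_def by auto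
qed simp

lemma node_count_insert:
  assumes "finite P" "p \<notin> P"
  shows "node_count (insert p P) e = of_bool (chord (fst p) (snd p) = e) + node_count P e"
proof -
  have "{q \<in> insert p P. chord (fst q) (snd q) = e} =
    (if chord (fst p) (snd p) = e then insert p {q \<in> P. chord (fst q) (snd q) = e}
     else {q \<in> P. chord (fst q) (snd q) = e})" by auto
  then show ?thesis using assms unfolding node_count_def by simp
qed

end

locale front_sweep = ngon +
  fixes A B :: "nat \<Rightarrow> int" and X :: nat
  assumes A_slice: "slice A" and B_slice: "slice B"
    and A_nonneg: "1 \<le> i \<Longrightarrow> i \<le> n - 3 \<Longrightarrow> 0 \<le> A i"
    and AB: "1 \<le> i \<Longrightarrow> i \<le> n - 3 \<Longrightarrow> A i \<le> B i"
    and B_le: "1 \<le> i \<Longrightarrow> i \<le> n - 3 \<Longrightarrow> B i \<le> int X"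
    and AB_out: "\<not> (1 \<le> i \<and> i \<le> n - 3) \<Longrightarrow> A i = B i"
begin

text \<open>
  The front \<open>i \<mapsto> x\<close> is the fan at vertex \<open>x\<close>; clamping the moving front between \<open>A\<close> and \<open>B\<close>
  gives a monotone walk from \<open>A\<close> to \<open>B\<close>.
\<close>

definition front :: "int \<Rightarrow> nat \<Rightarrow> nat \<Rightarrow> int" where
  "front x k i = (if 1 \<le> i \<and> i \<le> n - 3 then max (A i) (min (B i) (x + of_bool (i \<le> k))) else A i)"

definition front_move :: "int \<Rightarrow> nat \<Rightarrow> (nat \<times> int) list" where
  "front_move x k = (if A k \<le> x \<and> x < B k then [(k, 1)] else [])"

definition row :: "int \<Rightarrow> nat \<Rightarrow> (nat \<times> int) list" where
  "row x k = concat (map (\<lambda>j. front_move x (Suc j)) [0..<k])"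

definition sweep :: "nat \<Rightarrow> (nat \<times> int) list" where
  "sweep y = concat (map (\<lambda>x. row (int x) (n - 3)) [0..<y])"

lemma row_Suc: "row x (Suc k) = row x k @ front_move x (Suc k)"
  unfolding row_def by simp

lemma sweep_Suc: "sweep (Suc y) = sweep y @ row (int y) (n - 3)"
  unfolding sweep_def by simp

lemma slice_front: "slice (front x k)"
proof (rule slice_cong)
  have "slice (\<lambda>i. x + of_bool (i \<le> k))" unfolding slice_def by auto
  then show "slice (\<lambda>i. max (A i) (min (B i) (x + of_bool (i \<le> k))))"
    using A_slice B_slice slice_max slice_min by blast
qed (simp add: front_def)

lemma final_front_move:
  assumes "Suc k \<le> n - 3"
  shows "final (front x k) (front_move x (Suc k)) = front x (Suc k)"
proof
  fix i
  show "final (front x k) (front_move x (Suc k)) i = front x (Suc k) i"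
    using assms AB[of "Suc k"] unfolding front_move_def apply_move_def front_def
    by (cases "i = Suc k") (auto simp: le_Suc_eq)
qed

lemma walk_front_move:
  assumes "Suc k \<le> n - 3"
  shows "walk (front x k) (front_move x (Suc k))"
  using final_front_move[OF assms, of x] assms slice_front[of x k] slice_front[of x "Suc k"]
  unfolding front_move_def by (auto split: if_splits)

lemma final_row: "k \<le> n - 3 \<Longrightarrow> final (front x 0) (row x k) = front x k"
  by (induction k) (simp_all add: row_Suc final_front_move, simp add: row_def)

lemma front_next_row: "front x (n - 3) = front (x + 1) 0"
  unfolding front_def by auto

lemma final_sweep: "final (front 0 0) (sweep y) = front (int y) 0"
  by (induction y) (simp_all add: sweep_Suc final_row front_next_row add.commute, simp add: sweep_def)

lemma front_start: "front 0 0 = A"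
proof
  fix i show "front 0 0 i = A i" using A_nonneg[of i] unfolding front_def by auto
qed

lemma front_end: "front (int X) 0 = B"
proof
  fix i show "front (int X) 0 i = B i" using B_le[of i] AB[of i] AB_out[of i] unfolding front_def by auto
qed

lemma final_sweep_end: "final A (sweep X) = B"
  using final_sweep[of X] unfolding front_start front_end .

lemma walk_row: "k \<le> n - 3 \<Longrightarrow> walk (front x 0) (row x k)"
  by (induction k) (simp_all add: row_Suc walk_append final_row walk_front_move, simp add: row_def slice_front)

lemma walk_sweep: "walk A (sweep y)"
proof -
  have "walk (front 0 0) (sweep y)"
    by (induction y) (simp_all add: sweep_Suc walk_append final_sweep walk_row, simp add: sweep_def slice_front)
  then show ?thesis unfolding front_start .
qed

lemma states_row: "k \<le> n - 3 \<Longrightarrow> g \<in> set (states (front x 0) (row x k)) \<Longrightarrow> \<exists>j. g = front x j"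
proof (induction k)
  case (Suc k)
  then show ?case
    by (auto simp: row_Suc states_append final_row front_move_def split: if_splits)
qed (simp add: row_def)

lemma states_sweep:
  assumes "g \<in> set (states A (sweep y))"
  shows "\<exists>x k. 0 \<le> x \<and> g = front x k"
proof -
  have "g \<in> set (states (front 0 0) (sweep y)) \<Longrightarrow> \<exists>x k. 0 \<le> x \<and> g = front x k"
  proof (induction y)
    case (Suc y)
    then show ?case using states_row[of "n - 3" g "int y"]
      by (auto simp: sweep_Suc states_append final_sweep) (metis of_nat_0_le_iff)
  qed (simp add: sweep_def)
  then show ?thesis using assms unfolding front_start by blast
qed

lemma sweep_up: "m \<in> set (sweep y) \<Longrightarrow> 1 \<le> fst m \<and> fst m \<le> n - 3 \<and> snd m = 1"
  unfolding sweep_def row_def front_move_def by (auto split: if_splits)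

definition nodes :: "(nat \<times> int) set" where
  "nodes = {p. 1 \<le> fst p \<and> fst p \<le> n - 3 \<and> A (fst p) \<le> snd p \<and> snd p < B (fst p)}"

text \<open>Column \<open>k\<close> passes once through each value from \<open>A k\<close> to
  \<open>B k - 1\<close>, leaving it in the row of that value.\<close>

lemma removed_sweep: "count_list (removed A (sweep X)) e = node_count nodes e"
proof -
  let ?c = "\<lambda>x k. of_bool (A k \<le> x \<and> x < B k \<and> chord k x = e) :: nat"
  have mv: "count_list (removed (front x k) (front_move x (Suc k))) e = ?c x (Suc k)" if "Suc k \<le> n - 3" for x k
    using that unfolding front_move_def front_def by (auto simp: max_def min_def)
  have row: "count_list (removed (front x 0) (row x k)) e = (\<Sum>j<k. ?c x (Suc j))" if "k \<le> n - 3" for x k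
    using that by (induction k) (simp_all add: row_Suc removed_append final_row mv, simp add: row_def)
  have "count_list (removed (front 0 0) (sweep y)) e = (\<Sum>x<y. \<Sum>j<n - 3. ?c (int x) (Suc j))" for y
    by (induction y) (simp_all add: sweep_Suc removed_append final_sweep row, simp add: sweep_def)
  then have "count_list (removed A (sweep X)) e = (\<Sum>x<X. \<Sum>j<n - 3. ?c (int x) (Suc j))"
    unfolding front_start by simp
  also have "\<dots> = (\<Sum>x<X. card {j. j < n - 3 \<and> A (Suc j) \<le> int x \<and> int x < B (Suc j) \<and> chord (Suc j) (int x) = e})"
    by (intro sum.cong refl) (simp add: Int_def)
  also have "\<dots> = card (SIGMA x:{..<X}. {j. j < n - 3 \<and> A (Suc j) \<le> int x \<and> int x < B (Suc j) \<and> chord (Suc j) (int x) = e})"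
    by simp
  also have "\<dots> = node_count nodes e"
    unfolding node_count_def
  proof (rule bij_betw_same_card[OF bij_betw_byWitness[where f' = "\<lambda>p. (nat (snd p), fst p - 1)"]])
    let ?A = "SIGMA x:{..<X}. {j. j < n - 3 \<and> A (Suc j) \<le> int x \<and> int x < B (Suc j) \<and> chord (Suc j) (int x) = e}"
    let ?B = "{p \<in> nodes. chord (fst p) (snd p) = e}"
    have B: "0 \<le> snd p \<and> snd p < int X \<and> 1 \<le> fst p" if "p \<in> ?B" for p
      using that A_nonneg[of "fst p"] B_le[of "fst p"] unfolding nodes_def by auto
    show "\<forall>p\<in>?A. (nat (snd (Suc (snd p), int (fst p))), fst (Suc (snd p), int (fst p)) - 1) = p" by auto
    show "\<forall>p\<in>?B. (Suc (snd (nat (snd p), fst p - 1)), int (fst (nat (snd p), fst p - 1))) = p"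
    proof
      fix p assume "p \<in> ?B"
      then show "(Suc (snd (nat (snd p), fst p - 1)), int (fst (nat (snd p), fst p - 1))) = p"
        using B[of p] by (cases p) (auto simp del: One_nat_def)
    qed
    show "(\<lambda>p. (Suc (snd p), int (fst p))) ` ?A \<subseteq> ?B" unfolding nodes_def by auto
    show "(\<lambda>p. (nat (snd p), fst p - 1)) ` ?B \<subseteq> ?A"
    proof (rule image_subsetI)
      fix p assume p: "p \<in> ?B"
      then have "Suc (fst p - 1) = fst p" "int (nat (snd p)) = snd p" "nat (snd p) < X" "fst p - 1 < n - 3"
        using B[OF p] unfolding nodes_def by auto
      then show "(nat (snd p), fst p - 1) \<in> ?A" using p unfolding nodes_def by simp
    qed
  qed
  finally show ?thesis .
qed

end

section \<open>Even multiplicity\<close>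

locale even_tour = cube_tour +
  fixes b :: nat
  assumes n_large: "20 \<le> n"
    and b_def: "b = 2 - n mod 2"
    and first: "hd (w 0) = 7"
    and last: "last (w (n - 1)) = b"
begin

text \<open>
  The walk through the cubes is left just before it returns to its first zigzag and is closed up by a
  second tour, from \<open>A\<close> to \<open>B\<close>, on which the heights always spread over at least 3; the cubes have
  spread at most 2. Column \<open>b\<close> is kept low at the beginning of the second tour, column 7 is high at
  its end.
\<close>

definition A :: "nat \<Rightarrow> int" where "A i = cube (int n) {} i - of_bool (i = b)"
definition B :: "nat \<Rightarrow> int" where "B i = cube (2 * int n) {} i + of_bool (i = 7)"

lemma b_cases: "b = 1 \<and> odd n \<or> b = 2 \<and> even n"
  unfolding b_def by (cases "even n") (auto simp: odd_iff_mod_2_eq_one)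

lemma b_cols: "b \<in> cols (int (n - 1))"
  using b_cases n_large unfolding cols_def by auto

lemma seven_cols: "7 \<in> cols 0" "7 \<in> cols (2 * int n)"
  using n_large unfolding cols_def by auto

text \<open>\<open>A\<close> is both the zigzag with column \<open>b\<close> lowered and the last
  cube vertex before the final toggle of \<open>b\<close>; the first view serves the sweep, the
  second the tour.\<close>

lemma A_cube: "A = cube (int (n - 1)) (cols (int (n - 1)) - {b})" (is "_ = cube ?t ?S")
proof
  fix i
  have "toggle b ?S = cols ?t" using b_cols unfolding toggle_def by auto
  then have "apply_move (cube ?t ?S) (b, 1) = cube (int n) {}"
    using apply_move_cube[OF b_cols, of ?S] cube_full[of ?t] n_large by (simp add: of_nat_diff)
  then have "(cube ?t ?S)(b := cube ?t ?S b + 1) = cube (int n) {}"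
    unfolding apply_move_def by simp
  from fun_cong[OF this, of i] show "A i = cube ?t ?S i"
    unfolding A_def by (auto split: if_splits)
qed

lemma B_cube: "B = cube (2 * int n) {7}"
proof
  fix i
  have "apply_move (cube (2 * int n) {}) (7, 1) = cube (2 * int n) {7}"
    using apply_move_cube[OF seven_cols(2), of "{}"] by (simp add: toggle_def)
  from fun_cong[OF this, of i] show "B i = cube (2 * int n) {7} i"
    unfolding B_def apply_move_def by (auto split: if_splits)
qed

lemma apply_move_A: "apply_move A (b, 1) = cube (int n) {}"
  unfolding apply_move_def A_def by auto

lemma cube_period: "1 \<le> i \<Longrightarrow> i \<le> n - 3 \<Longrightarrow> cube (t + 2 * int n) S i = cube t S i + int n"
proof -
  assume "1 \<le> i" "i \<le> n - 3"
  moreover have "t + 2 * int n - int i + of_bool (i \<in> S) = (t - int i + of_bool (i \<in> S)) + 2 * int n" by simp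
  ultimately show ?thesis unfolding cube_def by simp
qed

lemma AB_bounds:
  assumes "1 \<le> i" "i \<le> n - 3"
  shows "2 * A i \<le> int n - int i" "int n - int i - 1 - 2 * of_bool (i = b) \<le> 2 * A i"
    and "2 * int n - int i - 1 + 2 * of_bool (i = 7) \<le> 2 * B i"
    and "2 * B i \<le> 2 * int n - int i + 2 * of_bool (i = 7)"
  using cube_cases[of "{}" "int n" i] cube_cases[of "{}" "2 * int n" i] assms
  unfolding A_def B_def by (auto split: if_splits)

sublocale front_sweep n A B n
proof unfold_locales
  show "slice A" unfolding A_cube by (rule slice_cube) blast
  show "slice B" unfolding B_cube using seven_cols(2) by (intro slice_cube) simp
  fix i
  show "A i = B i" if "\<not> (1 \<le> i \<and> i \<le> n - 3)"
    using that b_cases n_large unfolding A_def B_def cube_def by auto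
  assume i: "1 \<le> i" "i \<le> n - 3"
  note bd = AB_bounds[OF i]
  show "0 \<le> A i" using bd(2) i n_large b_cases by (cases "i = b") auto
  show "A i \<le> B i" using bd i by (cases "i = b"; cases "i = 7") auto
  show "B i \<le> int n" using bd(4) i by (cases "i = 7") auto
qed

definition mid :: "(nat \<times> int) list" where "mid = butlast (tl (tour n))"

text \<open>The end letters prescribed for \<open>w 0\<close> and \<open>w (n - 1)\<close> give the
  columns. The last toggle produces the full set, which contains \<open>b\<close>, so it inserts
  \<open>b\<close> and the move goes upward.\<close>

lemma tour_mid: "tour n = (7, 1) # mid @ [(b, 1)]"
proof -
  have nb: "w t \<noteq> []" if "t < n" "i \<in> cols (int t)" for t i using w_count[OF that] by auto
  have w0: "w 0 = 7 # tl (w 0)" using nb[of 0 7] seven_cols(1) first n_large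
    by (metis list.collapse of_nat_0 less_le_trans zero_less_numeral)
  have n1: "n = Suc (n - 1)" "[0..<n] = 0 # [1..<n]" using n_large by (auto simp: upt_conv_Cons)
  have h: "tour n = (7, 1) # cube_moves {7} (tl (w 0)) @ concat (map (\<lambda>t. cube_moves {} (w t)) [1..<n])"
    unfolding tour_def n1(2) by (simp, subst w0) (simp add: toggle_def)
  define v where "v = butlast (w (n - 1))"
  have wl: "w (n - 1) = v @ [b]" using nb[of "n - 1" b] b_cols last n_large
    unfolding v_def by (metis append_butlast_last_id diff_less less_le_trans zero_less_numeral zero_less_one)
  have app: "cube_moves S (u @ [i]) = cube_moves S u @ [(i, if i \<in> fold toggle u S then - 1 else 1)]" for S u i
    by (induction u arbitrary: S) simp_all
  have "toggle b (fold toggle v {}) = cols (int (n - 1))"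
    using w_final[of "n - 1"] n_large unfolding wl by simp
  then have "b \<notin> fold toggle v {}" using b_cols unfolding toggle_def by (auto split: if_splits)
  then have "cube_moves {} (w (n - 1)) = cube_moves {} v @ [(b, 1)]" unfolding wl app by simp
  moreover have "tour n = tour (n - 1) @ cube_moves {} (w (n - 1))"
    using tour_Suc[of "n - 1"] unfolding n1(1)[symmetric] .
  ultimately have "tour n = tour (n - 1) @ cube_moves {} v @ [(b, 1)]" by simp
  moreover have "tour (n - 1) \<noteq> []"
  proof -
    have "n - 1 = Suc (n - 2)" using n_large by simp
    moreover have "\<exists>i. i \<in> cols (int (n - 2))"
    proof (cases "even n")
      case True
      then have "1 \<in> cols (int (n - 2))" using n_large unfolding cols_def by auto
      then show ?thesis ..
    next
      case False
      then have "2 \<in> cols (int (n - 2))" using n_large unfolding cols_def by auto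
      then show ?thesis ..
    qed
    then have "cube_moves {} (w (n - 2)) \<noteq> []" using nb[of "n - 2"] n_large
      by (metis length_0_conv length_cube_moves diff_less less_le_trans zero_less_numeral)
    ultimately show ?thesis by (simp add: tour_Suc)
  qed
  ultimately obtain xs where "tl (tour n) = xs @ [(b, 1)]" by (metis append.assoc tl_append2)
  then show ?thesis using h unfolding mid_def by (metis butlast_snoc list.sel(3))
qed

definition f1 :: "nat \<Rightarrow> int" where "f1 = cube 0 {7}"

lemma apply_first: "apply_move (cube 0 {}) (7, 1) = f1"
  using apply_move_cube[OF seven_cols(1), of "{}"] by (simp add: toggle_def f1_def)

lemma final_mid: "final f1 mid = A"
proof
  fix i
  have "apply_move (final f1 mid) (b, 1) = apply_move A (b, 1)"
    using final_tour[of n] unfolding tour_mid apply_move_A by (simp add: apply_first)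
  from fun_cong[OF this, of i] show "final f1 mid i = A i"
    unfolding apply_move_def by (auto split: if_splits)
qed

lemma states_tour: "states (cube 0 {}) (tour n) = cube 0 {} # states f1 mid @ [A]"
  unfolding tour_mid by (simp add: states_append apply_first final_mid)

section \<open>The second tour avoids the cubes and itself\<close>

lemma interior_cases:
  assumes "g \<in> set (tl (states A (sweep n)))"
  shows "\<exists>x k. 0 \<le> x \<and> g = front x k" "g \<noteq> A" "g \<noteq> B"
proof -
  have ne: "sweep n \<noteq> []" using assms by auto
  have st: "states A (sweep n) = A # tl (states A (sweep n))" using ne by (cases "sweep n") auto
  have ws: "(\<forall>g\<in>set (states A (sweep n)). weight A \<le> weight g \<and> weight g < weight B)"
    "distinct (map weight (states A (sweep n)))"
    using weight_states[of "sweep n" A] sweep_up unfolding final_sweep_end by blast+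
  have g: "g \<in> set (states A (sweep n))" using assms by (metis list.set_sel(2) tl_Nil)
  show "\<exists>x k. 0 \<le> x \<and> g = front x k" using states_sweep[OF g] .
  show "g \<noteq> B" using ws(1) g by auto
  show "g \<noteq> A" using ws(2) assms by (subst (asm) st) auto
qed

text \<open>\<open>A (n - 3)\<close> is 1, while all other columns start at 2 or more. The first
  move of the sweep therefore raises column \<open>n - 3\<close> to 2.\<close>

lemma interior_last_col:
  assumes "g \<in> set (tl (states A (sweep n)))"
  shows "2 \<le> g (n - 3)"
proof (rule ccontr)
  assume le: "\<not> 2 \<le> g (n - 3)"
  obtain x k where g: "g = front x k" using interior_cases(1)[OF assms] by blast
  have l: "1 \<le> n - 3" "int (n - 3) = int n - 3" "n - 3 \<noteq> b" "n - 3 \<noteq> 7" using n_large b_cases by auto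
  have last: "A (n - 3) = 1" "2 \<le> B (n - 3)" using AB_bounds[OF l(1) order_refl] l n_large by auto
  have small: "x + of_bool (n - 3 \<le> k) \<le> 1" using le l(1) last unfolding g front_def by auto
  have "front x k i = A i" for i
  proof (cases "1 \<le> i \<and> i < n - 3")
    case True
    then have "2 \<le> A i" using AB_bounds(2)[of i] b_cases n_large by (cases "i = b") auto
    moreover have "x + of_bool (i \<le> k) \<le> 2" using small by (auto split: if_splits simp: of_bool_def)
    ultimately show ?thesis using True unfolding front_def by auto
  next
    case False
    then have "i = n - 3 \<or> \<not> (1 \<le> i \<and> i \<le> n - 3)" by linarith
    then show ?thesis using small last l(1) unfolding front_def by auto
  qed
  then show False using interior_cases(2)[OF assms] g by blast
qed

lemma interior_spread:
  assumes "g \<in> set (tl (states A (sweep n)))"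
  shows "\<exists>i j. 1 \<le> i \<and> i \<le> n - 3 \<and> 1 \<le> j \<and> j \<le> n - 3 \<and> height g i + 3 \<le> height g j"
proof -
  obtain x k where g: "g = front x k" using interior_cases(1)[OF assms] by blast
  have b: "1 \<le> b" "b \<le> n - 3" "b \<noteq> 7" and l: "1 \<le> n - 3" "int (n - 3) = int n - 3" and s7: "1 \<le> (7::nat)" "7 \<le> n - 3"
    using b_cases n_large by auto
  have ab: "2 * A b = int n - int b - 2"
  proof -
    have "even (int n - int b)" using b_cases by auto
    then obtain q where "int n - int b = 2 * q" by (elim evenE)
    then show ?thesis using b unfolding A_def cube_def by simp
  qed
  have "2 * int n - 6 \<le> 2 * B 7" "2 * B 7 \<le> 2 * int n - 5" using AB_bounds(3,4)[OF s7] by auto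
  then have b7: "2 * B 7 = 2 * int n - 6" by presburger
  \<comment> \<open>While column \<open>b\<close> rests it has height \<open>n - 1\<close>, and
    column \<open>n - 3\<close> has at least \<open>n + 2\<close>. While \<open>b\<close> has moved
    but 7 is unfinished, \<open>g b \<le> x + 1\<close> and \<open>x \<le> g 7\<close>, so a column
    at least \<open>b + 5\<close> gives spread 3; 7 is the least odd one, and columns of
    \<open>cols 0\<close> are odd. Once column 7 has reached \<open>2 * n + 2\<close>, an unfinished
    column is at most \<open>2 * n - 1\<close>.\<close>
  consider "g b = A b" | "g b \<noteq> A b" "x < B 7" | "B 7 \<le> x" by linarith
  then show ?thesis
  proof cases
    case 1
    then have "height g b = int n - 1" using ab unfolding height_def by simp
    moreover have "int n + 2 \<le> height g (n - 3)"
      using interior_last_col[OF assms] l unfolding height_def by simp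
    ultimately show ?thesis using b l(1) by (intro exI[of _ b] exI[of _ "n - 3"]) simp
  next
    case 2
    then have "g b \<le> x + 1" using b unfolding g front_def by (auto simp: max_def min_def split: if_splits)
    moreover have "x \<le> g 7" using 2(2) s7 unfolding g front_def by auto
    moreover have "int b \<le> 2" using b_cases by auto
    ultimately show ?thesis using b s7 unfolding height_def by (intro exI[of _ b] exI[of _ 7]) simp
  next
    case 3
    have g7: "g 7 = B 7" using 3 s7 AB[of 7] unfolding g front_def by auto
    obtain i where i: "g i \<noteq> B i" using interior_cases(3)[OF assms] by blast
    then have i1: "1 \<le> i" "i \<le> n - 3" "i \<noteq> 7" using AB_out[of i] g7 unfolding g front_def by (auto split: if_splits)
    then have "g i < B i" using i AB[of i] unfolding g front_def by auto
    then show ?thesis using AB_bounds(4)[OF i1(1,2)] i1 b7 g7 s7 unfolding height_def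
      by (intro exI[of _ i] exI[of _ 7]) auto
  qed
qed

lemma interior_slice: "g \<in> set (tl (states A (sweep n))) \<Longrightarrow> slice g"
  using interior_cases(1) slice_front by blast

text \<open>Translation and reversal add one constant to all heights, so the spread depends on the
  triangulation alone.\<close>

lemma interior_ne_cube:
  assumes g: "g \<in> set (tl (states A (sweep n)))" and S: "S \<subseteq> cols t"
  shows "tri g \<noteq> tri (cube t S)"
proof
  assume eq: "tri g = tri (cube t S)"
  obtain i j where ij: "1 \<le> i" "i \<le> n - 3" "1 \<le> j" "j \<le> n - 3" "height g i + 3 \<le> height g j"
    using interior_spread[OF g] by blast
  have r: "t \<le> height (cube t S) k \<and> height (cube t S) k \<le> t + 2" if "1 \<le> k" "k \<le> n - 3" for k
    using height_cube[OF S that] by auto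
  from tri_eq_height[OF interior_slice[OF g] slice_cube[OF S] eq] show False
  proof
    assume "\<exists>k. \<forall>i. 1 \<le> i \<and> i \<le> n - 3 \<longrightarrow> height (cube t S) i = height g i + 2 * k * int n"
    then obtain k where "\<And>i. 1 \<le> i \<Longrightarrow> i \<le> n - 3 \<Longrightarrow> height (cube t S) i = height g i + 2 * k * int n" by blast
    from this[of i] this[of j] show False using r[of i] r[of j] ij by linarith
  next
    assume "\<exists>k. \<forall>i. 1 \<le> i \<and> i \<le> n - 3 \<longrightarrow> height (cube t S) (n - 2 - i) = height g i + (2 * k + 1) * int n"
    then obtain k where "\<And>i. 1 \<le> i \<Longrightarrow> i \<le> n - 3 \<Longrightarrow>
      height (cube t S) (n - 2 - i) = height g i + (2 * k + 1) * int n" by blast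
    moreover have "1 \<le> n - 2 - i" "n - 2 - i \<le> n - 3" "1 \<le> n - 2 - j" "n - 2 - j \<le> n - 3" using ij n6 by auto
    ultimately show False using r[of "n - 2 - i"] r[of "n - 2 - j"] ij by (smt (verit))
  qed
qed

text \<open>The heights in column 1 lie between \<open>n - 2\<close> and \<open>2 * n\<close>, which
  rules out nonzero translations. A reversal swaps columns 1 and \<open>n - 3\<close>; since the
  latter has height at least \<open>n + 2\<close>, it would need an odd multiple of \<open>n\<close>
  strictly between \<open>- n\<close> and \<open>n\<close>.\<close>

lemma interior_weight:
  assumes g: "g \<in> set (tl (states A (sweep n)))" and h: "h \<in> set (tl (states A (sweep n)))"
    and eq: "tri g = tri h"
  shows "weight g = weight h"
proof -
  have l: "1 \<le> n - 3" "int (n - 3) = int n - 3" "n - 2 - (n - 3) = 1" "n - 2 - 1 = n - 3" using n_large by auto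
  have bd: "int n - 2 \<le> height f 1 \<and> height f 1 \<le> 2 * int n \<and> int n + 2 \<le> height f (n - 3)"
    if f: "f \<in> set (tl (states A (sweep n)))" for f
  proof -
    obtain x k where "f = front x k" using interior_cases(1)[OF f] by blast
    then have "A 1 \<le> f 1" "f 1 \<le> B 1" using l(1) AB[of 1] unfolding front_def by auto
    then show ?thesis using AB_bounds[OF order_refl l(1)] interior_last_col[OF f] l(2) unfolding height_def
      by (cases "b = 1") auto
  qed
  from tri_eq_height[OF interior_slice[OF g] interior_slice[OF h] eq] show ?thesis
  proof
    assume "\<exists>k. \<forall>i. 1 \<le> i \<and> i \<le> n - 3 \<longrightarrow> height h i = height g i + 2 * k * int n"
    then obtain k where k: "\<And>i. 1 \<le> i \<Longrightarrow> i \<le> n - 3 \<Longrightarrow> height h i = height g i + 2 * k * int n" by blast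
    have "\<bar>2 * k * int n\<bar> < 2 * int n" using k[of 1] bd[OF g] bd[OF h] l(1) n_large by auto
    then have "\<bar>k\<bar> * (2 * int n) < 1 * (2 * int n)" using n_large by (simp add: abs_mult)
    then have "\<bar>k\<bar> < 1" by (rule mult_right_less_imp_less) simp
    then have "k = 0" by simp
    then have "h i = g i" if "1 \<le> i" "i \<le> n - 3" for i using k[OF that] unfolding height_def by simp
    then show ?thesis unfolding weight_def by (intro sum.cong) auto
  next
    assume "\<exists>k. \<forall>i. 1 \<le> i \<and> i \<le> n - 3 \<longrightarrow> height h (n - 2 - i) = height g i + (2 * k + 1) * int n"
    then obtain k where k: "\<And>i. 1 \<le> i \<Longrightarrow> i \<le> n - 3 \<Longrightarrow>
      height h (n - 2 - i) = height g i + (2 * k + 1) * int n" by blast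
    have "height h 1 = height g (n - 3) + (2 * k + 1) * int n" "height h (n - 3) = height g 1 + (2 * k + 1) * int n"
      using k[of "n - 3"] k[of 1] l by auto
    then have "(2 * k + 1) * int n < 1 * int n" "(- 1) * int n < (2 * k + 1) * int n"
      using bd[OF g] bd[OF h] by linarith+
    then have "2 * k + 1 < 1" "- 1 < 2 * k + 1" using mult_right_less_imp_less[of _ "int n"] by (metis of_nat_0_le_iff)+
    then show ?thesis by presburger
  qed
qed

lemma distinct_even: "distinct (map tri (states f1 (mid @ sweep n)))"
proof -
  let ?V = "tl (states A (sweep n))"
  have tour: "distinct (map tri (states f1 mid @ [A]))"
    using distinct_tour[of n] unfolding states_tour by simp
  have "distinct (map weight (states A (sweep n)))"
    using weight_states[of "sweep n" A] sweep_up by blast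
  then have "distinct (map weight ?V)" unfolding map_tl by (rule distinct_tl)
  then have iw: "inj_on weight (set ?V)" and dV: "distinct ?V" by (simp_all only: distinct_map)
  have "inj_on tri (set ?V)"
  proof (rule inj_onI)
    fix g h assume gh: "g \<in> set ?V" "h \<in> set ?V" "tri g = tri h"
    show "g = h" using inj_onD[OF iw interior_weight[OF gh] gh(1,2)] .
  qed
  then have V: "distinct (map tri ?V)" using dV by (simp only: distinct_map)
  have ne: "tri g \<noteq> tri f" if f: "f \<in> set (states f1 mid @ [A])" and g: "g \<in> set ?V" for f g
  proof -
    have "f \<in> set (states (cube 0 {}) (tour n))" using f unfolding states_tour by auto
    then obtain t S where "S \<subset> cols (int t)" "f = cube (int t) S" using mem_states_tour[of n f] by blast
    then show ?thesis using interior_ne_cube[OF g, of S "int t"] by auto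
  qed
  have "sweep n \<noteq> []"
  proof
    assume "sweep n = []"
    then have "A 3 = B 3" using final_sweep_end by simp
    moreover have "1 \<le> (3 :: nat)" "3 \<le> n - 3" using n_large by auto
    ultimately show False using AB_bounds(1,3)[of 3] n_large by auto
  qed
  then have "states A (sweep n) = [A] @ ?V" by (cases "sweep n") auto
  then have "states f1 (mid @ sweep n) = (states f1 mid @ [A]) @ ?V"
    unfolding states_append final_mid by simp
  then show ?thesis using tour V ne by (auto simp del: append_assoc)
qed

text \<open>Between the zigzags at \<open>n\<close> and \<open>2 * n\<close> the nodes form one
  window. Lowering \<open>b\<close> at the start and raising 7 at the end add one node each.\<close>

lemma nodes_eq: "nodes = insert (b, A b) (insert (7, cube (2 * int n) {} 7) (window (int n)))"
proof (intro set_eqI)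
  fix p :: "nat \<times> int"
  obtain i x where p: "p = (i, x)" by (metis surj_pair)
  have b: "1 \<le> b" "b \<le> n - 3" "b \<noteq> 7" "(7::nat) \<le> n - 3" using b_cases n_large by auto
  show "p \<in> nodes \<longleftrightarrow> p \<in> insert (b, A b) (insert (7, cube (2 * int n) {} 7) (window (int n)))"
  proof (cases "1 \<le> i \<and> i \<le> n - 3")
    case True
    then have i: "1 \<le> i" "i \<le> n - 3" by auto
    have "cube (int n) {} i \<le> x \<longleftrightarrow> int n \<le> 2 * x + int i + 1"
      using cube_cases[of "{}" "int n" i] i by (auto split: if_splits)
    moreover have "x < cube (2 * int n) {} i \<longleftrightarrow> 2 * x + int i + 1 < 2 * int n"
      using cube_cases[of "{}" "2 * int n" i] i by (auto split: if_splits)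
    ultimately have "p \<in> window (int n) \<longleftrightarrow> cube (int n) {} i \<le> x \<and> x < cube (2 * int n) {} i"
      unfolding window_def p using i by auto
    moreover have "cube (int n) {} i < cube (2 * int n) {} i"
      using cube_cases[of "{}" "int n" i] cube_cases[of "{}" "2 * int n" i] i n_large by (auto split: if_splits)
    ultimately show ?thesis using i b unfolding nodes_def p A_def B_def by auto
  next
    case False
    then show ?thesis using b unfolding nodes_def window_def p by auto
  qed
qed

text \<open>Cutting off the first and last move of the tour loses one removal of a chord in column 7
  and one in column \<open>b\<close>. The two extra nodes of the sweep restore exactly these, the
  former after a translation by \<open>n\<close>.\<close>

lemma removed_even:
  assumes e: "e \<in> diagonals n"
  shows "count_list (removed f1 (mid @ sweep n)) e = 2 * s + 2"
proof -
  have b: "1 \<le> b" "b \<le> n - 3" "b \<noteq> 7" "(7::nat) \<le> n - 3" using b_cases n_large by auto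
  have "(7, cube (2 * int n) {} 7) \<notin> window (int n)"
    using cube_cases[of "{}" "2 * int n" 7] seven_cols b unfolding window_def by auto
  moreover have "(b, A b) \<notin> insert (7, cube (2 * int n) {} 7) (window (int n))"
    using AB_bounds(1)[OF b(1,2)] cube_cases[of "{}" "int n" b] b unfolding window_def A_def by (auto split: if_splits)
  ultimately have nd: "node_count nodes e = of_bool (chord b (A b) = e) + of_bool (chord 7 (cube (2 * int n) {} 7) = e) + 1"
    unfolding nodes_eq using finite_window node_count_window[OF e] by (simp add: node_count_insert)
  have "cube (2 * int n) {} 7 = cube 0 {} 7 + 1 * int n" using cube_period[of 7 0 "{}"] b by simp
  then have c7: "chord 7 (cube (2 * int n) {} 7) = chord 7 (cube 0 {} 7)" by (simp only: chord_shift)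
  have "2 * s + 1 = of_bool (chord 7 (cube 0 {} 7) = e) + count_list (removed f1 mid) e + of_bool (chord b (A b) = e)"
    using removed_tour[OF e] unfolding tour_mid by (simp add: removed_append apply_first final_mid split: if_splits)
  then show ?thesis using nd removed_sweep[of e] unfolding removed_append final_mid c7 by simp
qed

lemma even_rainbow: "rainbow_cycle n (2 * s + 2) (map tri (states f1 (mid @ sweep n)))"
proof (rule rainbow_cycle_walk)
  have "walk (cube 0 {}) (tour n)" by (rule walk_tour) simp
  then have "walk f1 mid" unfolding tour_mid by (simp add: apply_first walk_append)
  then show "walk f1 (mid @ sweep n)" using walk_sweep by (simp add: walk_append final_mid)
  show "tri (final f1 (mid @ sweep n)) = tri f1"
  proof -
    have "chord i (B i) = chord i (f1 i)" if "1 \<le> i" "i \<le> n - 3" for i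
      using cube_period[OF that, of 0 "{7}"] chord_shift[of i "f1 i" 1] unfolding B_cube f1_def by simp
    then have "tri B = tri f1" unfolding tri_def by (intro Collect_cong ex_cong1) auto
    then show ?thesis by (simp add: final_mid final_sweep_end)
  qed
  show "3 \<le> length (mid @ sweep n)"
    using length_ge_3[OF _ removed_even] by simp
qed (use distinct_even removed_even in auto)

end

theorem theorem2p1:
  fixes n r :: nat
  assumes "45 \<le> n" and "1 \<le> r" and "r \<le> 2 * n + 2"
  shows "\<exists>Ts. rainbow_cycle n r Ts"
proof -
  interpret ngon n by unfold_locales (use assms(1) in simp)
  define s where "s = (r - 1) div 2"
  have r: "r = 2 * s + 1 \<or> r = 2 * s + 2" using assms(2) unfolding s_def by presburger
  define b where "b = 2 - n mod 2"
  define c :: "nat \<Rightarrow> nat" where "c t = (if t = 0 then 7 else if t = n - 1 then b else SOME i. i \<in> cols (int t))" for t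
  have b: "b = 1 \<and> odd n \<or> b = 2 \<and> even n" unfolding b_def by (cases "even n") (auto simp: odd_iff_mod_2_eq_one)
  \<comment> \<open>\<open>45 \<le> n\<close> gives \<open>21 \<le> (n - 3) div 2\<close>, and
    \<open>r \<le> 2 * n + 2\<close> gives \<open>s \<le> n\<close>, which is at most
    \<open>2 * ((n - 3) div 2) + 4\<close>.\<close>
  have card: "21 \<le> card (cols t)" "s \<le> 2 * card (cols t) + 4" for t
    using card_cols[of t] assms r by linarith+
  have c: "c t \<in> cols (int t)" for t
  proof -
    have "7 \<in> cols 0" "b \<in> cols (int (n - 1))" using assms(1) b unfolding cols_def by auto
    moreover have "cols (int t) \<noteq> {}" using card(1)[of "int t"] by auto
    ultimately show ?thesis unfolding c_def by (auto intro: someI_ex)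
  qed
  have "\<exists>v. set v \<subseteq> cols (int t) \<and> (\<forall>i\<in>cols (int t). count_list v i = 2 * s + 1) \<and>
    distinct (trace {} v) \<and> fold toggle v {} = cols (int t) \<and> cols (int t) \<notin> set (trace {} v) \<and>
    (if t = 0 then hd v else last v) = c t" for t
    using exists_word[OF finite_cols card c] by blast
  then obtain w where w: "\<And>t. set (w t) \<subseteq> cols (int t) \<and> (\<forall>i\<in>cols (int t). count_list (w t) i = 2 * s + 1) \<and>
    distinct (trace {} (w t)) \<and> fold toggle (w t) {} = cols (int t) \<and> cols (int t) \<notin> set (trace {} (w t)) \<and>
    (if t = 0 then hd (w t) else last (w t)) = c t" by metis
  interpret even_tour n s w b
  proof unfold_locales
    show "hd (w 0) = 7" using w[of 0] unfolding c_def by simp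
    show "last (w (n - 1)) = b" using w[of "n - 1"] assms(1) unfolding c_def by simp
  qed (use w assms(1) b_def in auto)
  show ?thesis using r odd_rainbow even_rainbow by blast
qed

end
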